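(* Let $U,V\subset\mathbb{R}^n$ be open and connected, and let $k\in\mathbb{N}$. For any function $\psi:U\times V\to\mathbb{R}$ that is analytic in $V$, the following three conditions are equivalent: (1) $\mathrm{rank}(\psi)=k$. (2) $\psi(x,y)=\sum_{j=1}^k\phi_j(x)\xi_j(y)$ for all $(x,y)\in U\times V$, for linearly independent functions $\phi_j:U\to\mathbb{R}$, $j=1,\dots,k$, and linearly independent functions $\xi_j\in C^\infty(V)$, $j=1,\dots,k$. (3) For arbitrary $p\in V$, let $c_s$ be the Taylor functions of $\psi$ about $p$. Then the vector space $\mathrm{span}\{c_1,c_2,\dots\}$ of all finite linear combinations of the $c_s$ has a finite basis of size $k$ in $U$.
   Context: A function $\psi:U\times V\to\mathbb{R}$ has rank $k$, written $\mathrm{rank}(\psi)=k$, if for any $m\in\mathbb{N}$, $x_i\in U$, $y_j\in V$, $i,j=1,\dots,m$, one has $\mathrm{rank}(\{\psi(x_i,y_j)\}_{i,j=1}^m)\le k$, and $k$ is the smallest number with this property. A collection of functions $f_s:U\to\mathbb{R}$ is linearly independent in $U$ if $\sum_s\alpha_sf_s(x)=0$ for (Lebesgue) almost all $x\in U$ only if $\alpha_s=0$ for all $s$. Multi-index notation: for $s=(s_1,\dots,s_n)\in\mathbb{Z}_{\ge0}^n$, $[s]=s_1+\dots+s_n$ and $(y-p)^s=(y_1-p_1)^{s_1}\cdots(y_n-p_n)^{s_n}$. A function $\psi:U\times V\to\mathbb{R}$ is analytic in $V$ if about any $p\in V$ one can write $$\psi(x,y)=\sum_{l=0}^\infty\ \sum_{s:[s]=l}c_s(x)(y-p)^s$$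 for some functions $c_s$ on $U$ (depending on $p$), where the series converges to $\psi(x,y)$ for any $(x,y)\in U\times V$. The $c_s$ are called the Taylor functions of $\psi$ about $p$; $c_s(x)=\frac{1}{s!}\frac{\partial^s\psi}{\partial y^s}(x,p)$. It is moreover assumed that for all $x\in U$, $p\in V$ the closed ball centred at $p$ whose radius is the convergence radius of this series encloses $V$. The Taylor functions, indexed by multi-indices, are enumerated as $c_1,c_2,\dots$. The space $\mathrm{span}\{c_1,c_2,\dots\}$ has a finite basis of size $m$ if it has a basis consisting of $m$ functions $c_{s_1},\dots,c_{s_m}$, so that $c_s\in\mathrm{span}\{c_{s_1},\dots,c_{s_m}\}$ for all $s$.
   Formalization: (1) implies (2),(3) is proved only if every finite combination of the functions ψ(·,y) vanishing a.e. on U vanishes on U (implied by (2); true if ψ is continuous in x); without it ψ(x,y)=1 for x=a, else 0, is a counterexample. V is assumed nonempty. *)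

theory Defs
  imports "HOL-Analysis.Analysis" "Jordan_Normal_Form.DL_Rank"
begin

section \<open>Rank of a function of two variables\<close>

text \<open>The matrix size \<open>m\<close> is quantified, so matrices with explicit dimensions are
  used here instead of the type-indexed ones.\<close>

definition rank_at_most :: "'a set \<Rightarrow> 'b set \<Rightarrow> ('a \<Rightarrow> 'b \<Rightarrow> real) \<Rightarrow> nat \<Rightarrow> bool" where
  "rank_at_most U V \<psi> k \<longleftrightarrow>
     (\<forall>(m::nat) x y. (\<forall>i<m. x i \<in> U \<and> y i \<in> V) \<longrightarrow>
        vec_space.rank m (mat m m (\<lambda>(i, j). \<psi> (x i) (y j))) \<le> k)"

definition has_rank :: "'a set \<Rightarrow> 'b set \<Rightarrow> ('a \<Rightarrow> 'b \<Rightarrow> real) \<Rightarrow> nat \<Rightarrow> bool" where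
  "has_rank U V \<psi> k \<longleftrightarrow>
     rank_at_most U V \<psi> k \<and> (\<forall>k'. rank_at_most U V \<psi> k' \<longrightarrow> k \<le> k')"

section \<open>Linear independence up to null sets\<close>

definition lin_indep_ae ::
  "'i set \<Rightarrow> ('i \<Rightarrow> 'a::euclidean_space \<Rightarrow> real) \<Rightarrow> 'a set \<Rightarrow> bool" where
  "lin_indep_ae I f U \<longleftrightarrow>
     (\<forall>J \<alpha>. finite J \<and> J \<subseteq> I \<and> (AE x\<in>U in lebesgue. (\<Sum>s\<in>J. \<alpha> s * f s x) = 0)
        \<longrightarrow> (\<forall>s\<in>J. \<alpha> s = 0))"

section \<open>Smooth functions\<close>

text \<open>\<open>C_k k V f\<close>: all iterated partial derivatives of \<open>f\<close> up to order \<open>k\<close> exist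
  and are continuous on the open set \<open>V\<close>.\<close>

primrec C_k :: "nat \<Rightarrow> (real^'n) set \<Rightarrow> (real^'n \<Rightarrow> real) \<Rightarrow> bool" where
  "C_k 0 V f \<longleftrightarrow> continuous_on V f"
| "C_k (Suc k) V f \<longleftrightarrow> continuous_on V f \<and>
     (\<exists>g. (\<forall>i. \<forall>y\<in>V. ((\<lambda>t. f (y + t *\<^sub>R axis i 1)) has_real_derivative g i y) (at 0)) \<and>
          (\<forall>i. C_k k V (g i)))"

definition C_infinity :: "(real^'n) set \<Rightarrow> (real^'n \<Rightarrow> real) \<Rightarrow> bool" where
  "C_infinity V f \<longleftrightarrow> (\<forall>k. C_k k V f)"

section \<open>Analyticity in the second variable\<close>

text \<open>Multi-indices are functions \<^typ>\<open>'n \<Rightarrow> nat\<close>; since \<open>'n\<close> is finite, only finitely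
  many of them have a given degree.\<close>

definition multi_degree :: "('n::finite \<Rightarrow> nat) \<Rightarrow> nat" where
  "multi_degree s = (\<Sum>i\<in>UNIV. s i)"

definition multi_power :: "real^'n \<Rightarrow> ('n \<Rightarrow> nat) \<Rightarrow> real" where
  "multi_power z s = (\<Prod>i\<in>UNIV. (z $ i) ^ s i)"

definition homogeneous_part :: "(('n \<Rightarrow> nat) \<Rightarrow> real) \<Rightarrow> nat \<Rightarrow> real^'n \<Rightarrow> real" where
  "homogeneous_part a l z = (\<Sum>s | multi_degree s = l. a s * multi_power z s)"

definition multi_conv_radius :: "(('n::finite \<Rightarrow> nat) \<Rightarrow> real) \<Rightarrow> ereal" where
  "multi_conv_radius a =
     Sup {ereal r | r. \<forall>z::real^'n. norm z < r \<longrightarrow> summable (\<lambda>l. homogeneous_part a l z)}"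

text \<open>The coefficient functions of such an expansion on an open set \<open>V\<close> are uniquely
  determined on \<open>U\<close> by \<open>\<psi>\<close> and \<open>p\<close>.\<close>

definition taylor_functions ::
  "(real^'n) set \<Rightarrow> (real^'n) set \<Rightarrow> (real^'n \<Rightarrow> real^'n \<Rightarrow> real) \<Rightarrow> real^'n \<Rightarrow>
   (('n \<Rightarrow> nat) \<Rightarrow> real^'n \<Rightarrow> real) \<Rightarrow> bool" where
  "taylor_functions U V \<psi> p c \<longleftrightarrow>
     (\<forall>x\<in>U. \<forall>y\<in>V. (\<lambda>l. homogeneous_part (\<lambda>s. c s x) l (y - p)) sums \<psi> x y)"

definition analytic_in_snd ::
  "(real^'n) set \<Rightarrow> (real^'n) set \<Rightarrow> (real^'n \<Rightarrow> real^'n \<Rightarrow> real) \<Rightarrow> bool" where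
  "analytic_in_snd U V \<psi> \<longleftrightarrow>
     (\<forall>p\<in>V. \<exists>c. taylor_functions U V \<psi> p c \<and>
        (\<forall>x\<in>U. \<forall>y\<in>V. ereal (dist p y) \<le> multi_conv_radius (\<lambda>s. c s x)))"

section \<open>Finite bases of the span of a family\<close>

definition span_has_basis_of_size ::
  "'i set \<Rightarrow> ('i \<Rightarrow> 'a::euclidean_space \<Rightarrow> real) \<Rightarrow> 'a set \<Rightarrow> nat \<Rightarrow> bool" where
  "span_has_basis_of_size I c U m \<longleftrightarrow>
     (\<exists>B\<subseteq>I. finite B \<and> card B = m \<and> lin_indep_ae B c U \<and>
        (\<forall>s\<in>I. \<exists>\<alpha>. \<forall>x\<in>U. c s x = (\<Sum>t\<in>B. \<alpha> t * c t x)))"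

section \<open>Separable representations\<close>

definition separable_with ::
  "(real^'n) set \<Rightarrow> (real^'n) set \<Rightarrow> (real^'n \<Rightarrow> real^'n \<Rightarrow> real) \<Rightarrow> nat \<Rightarrow> bool" where
  "separable_with U V \<psi> k \<longleftrightarrow>
     (\<exists>\<phi> \<xi>. lin_indep_ae {1..k} \<phi> U \<and> lin_indep_ae {1..k} \<xi> V \<and>
        (\<forall>j\<in>{1..k}. C_infinity V (\<xi> j)) \<and>
        (\<forall>x\<in>U. \<forall>y\<in>V. \<psi> x y = (\<Sum>j=1..k. \<phi> j x * \<xi> j y)))"

section \<open>Compatibility with null sets\<close>

text \<open>Rank is a pointwise notion, while linear independence ignores null sets. For
  discontinuous \<open>\<psi>\<close> these can disagree: if \<open>\<psi> x y = (if x = a then 1 else 0)\<close> with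
  \<open>a \<in> U\<close>, then \<open>\<psi>\<close> has rank 1, but \<open>\<phi> x * \<xi> y = \<psi> x y\<close> forces \<open>\<phi>\<close> to vanish off \<open>a\<close>, so \<open>\<phi>\<close>
  is not linearly independent in \<open>U\<close>. The following property excludes this. It holds whenever \<open>\<psi>\<close> is
  continuous in \<open>x\<close>, and it is necessary for a decomposition with linearly independent
  \<open>\<phi>\<^sub>j\<close>; both facts are proved below.\<close>

definition null_combinations_vanish ::
  "'a::euclidean_space set \<Rightarrow> 'b set \<Rightarrow> ('a \<Rightarrow> 'b \<Rightarrow> real) \<Rightarrow> bool" where
  "null_combinations_vanish U V \<psi> \<longleftrightarrow>
     (\<forall>S \<alpha>. finite S \<and> S \<subseteq> V \<and> (AE x\<in>U in lebesgue. (\<Sum>y\<in>S. \<alpha> y * \<psi> x y) = 0)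
        \<longrightarrow> (\<forall>x\<in>U. (\<Sum>y\<in>S. \<alpha> y * \<psi> x y) = 0))"

lemma null_combinations_vanish_if_continuous:
  fixes \<psi> :: "'a::euclidean_space \<Rightarrow> 'b \<Rightarrow> real"
  assumes "open U" and cont: "\<And>y. y \<in> V \<Longrightarrow> continuous_on U (\<lambda>x. \<psi> x y)"
  shows "null_combinations_vanish U V \<psi>"
  unfolding null_combinations_vanish_def
proof (intro allI impI ballI, elim conjE)
  fix S \<alpha> x
  assume S: "S \<subseteq> V" and x: "x \<in> U"
    and ae: "AE x\<in>U in lebesgue. (\<Sum>y\<in>S. \<alpha> y * \<psi> x y) = 0"
  define g where "g = (\<lambda>x. \<Sum>y\<in>S. \<alpha> y * \<psi> x y)"
  have "continuous_on U g"
    unfolding g_def using S by (intro continuous_intros cont) auto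
  then have "open (U \<inter> g -` (- {0}))"
    using \<open>open U\<close> by (rule continuous_open_preimage) (intro open_Compl closed_singleton)
  then have "closed (- (U \<inter> g -` (- {0})))"
    by blast
  moreover have "AE x in lebesgue. x \<in> - (U \<inter> g -` (- {0}))"
    using ae by eventually_elim (auto simp: g_def)
  ultimately have "x \<in> - (U \<inter> g -` (- {0}))"
    by (rule mem_closed_if_AE_lebesgue)
  then show "(\<Sum>y\<in>S. \<alpha> y * \<psi> x y) = 0"
    using x by (auto simp: g_def)
qed

lemma null_combinations_vanish_if_separable:
  assumes "separable_with U V \<psi> k"
  shows "null_combinations_vanish U V \<psi>"
  unfolding null_combinations_vanish_def
proof (intro allI impI ballI, elim conjE)
  fix S \<alpha> x
  assume S: "S \<subseteq> V" and x: "x \<in> U"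
    and ae: "AE x\<in>U in lebesgue. (\<Sum>y\<in>S. \<alpha> y * \<psi> x y) = 0"
  obtain \<phi> \<xi> where indep: "lin_indep_ae {1..k} \<phi> U"
    and eq: "\<And>x y. x \<in> U \<Longrightarrow> y \<in> V \<Longrightarrow> \<psi> x y = (\<Sum>j=1..k. \<phi> j x * \<xi> j y)"
    using assms unfolding separable_with_def by blast
  define \<beta> where "\<beta> = (\<lambda>j. \<Sum>y\<in>S. \<alpha> y * \<xi> j y)"
  have *: "(\<Sum>y\<in>S. \<alpha> y * \<psi> x y) = (\<Sum>j=1..k. \<beta> j * \<phi> j x)" if "x \<in> U" for x
  proof -
    have "(\<Sum>y\<in>S. \<alpha> y * \<psi> x y) = (\<Sum>y\<in>S. \<Sum>j=1..k. \<alpha> y * \<xi> j y * \<phi> j x)"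
      using S that by (intro sum.cong) (auto simp: eq sum_distrib_left mult_ac)
    also have "\<dots> = (\<Sum>j=1..k. \<beta> j * \<phi> j x)"
      unfolding \<beta>_def by (subst sum.swap) (simp add: sum_distrib_right)
    finally show ?thesis .
  qed
  have "AE x\<in>U in lebesgue. (\<Sum>j=1..k. \<beta> j * \<phi> j x) = 0"
    using ae by eventually_elim (simp add: *)
  then have "\<forall>j\<in>{1..k}. \<beta> j = 0"
    using indep unfolding lin_indep_ae_def by blast
  then show "(\<Sum>y\<in>S. \<alpha> y * \<psi> x y) = 0"
    by (simp add: * x)
qed

end

theory Submission
  imports Defs
begin

text \<open>Linearly independent functions \<open>f\<^sub>1, \<dots>, f\<^sub>k\<close> on a set admit points \<open>x\<^sub>1, \<dots>, x\<^sub>k\<close> at which the matrix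
  \<open>f\<^sub>j (x\<^sub>i)\<close> is invertible, so each factor of a representation \<open>\<psi> x y = (\<Sum>j. \<phi>\<^sub>j x * \<xi>\<^sub>j y)\<close> is a
  finite linear combination of sections of \<open>\<psi>\<close>. In particular the \<open>\<xi>\<^sub>j\<close> inherit power series from \<open>\<psi>\<close>, and by
  uniqueness of coefficients the Taylor functions are \<open>c\<^sub>s = (\<Sum>j. e\<^sub>j s * \<phi>\<^sub>j)\<close>, where \<open>e\<^sub>j\<close> are the
  coefficients of \<open>\<xi>\<^sub>j\<close>; the \<open>e\<^sub>j\<close> are linearly independent because the \<open>\<xi>\<^sub>j\<close> are, and so \<open>k\<close> of the
  \<open>c\<^sub>s\<close> form a basis. Conversely, expanding the \<open>c\<^sub>s\<close> in a basis, or the sections \<open>\<psi> \<cdot> y\<close> in a maximal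
  independent family, yields the representation.

  Smoothness of the \<open>\<xi>\<^sub>j\<close> is the analytic part, since the series converge only when grouped by degree:
  Baire's theorem and finite differences give geometric bounds on the coefficients, after which
  termwise differentiation is allowed.\<close>

section \<open>Coefficients of series of homogeneous polynomials\<close>

text \<open>The induction builds the weights of the \<open>m\<close>-th forward difference with step
  \<delta>; each differencing lowers the degree of a polynomial by one. The base point
  \<open>w\<close> is arbitrary because the position of the grid cannot be controlled later.\<close>

lemma finite_difference:
  fixes \<delta> :: real
  shows "\<exists>b::nat \<Rightarrow> real. (\<Sum>k\<le>m. \<bar>b k\<bar>) \<le> 2 ^ m \<and>
    (\<forall>w t. t \<le> m \<longrightarrow> (\<Sum>k\<le>m. b k * (w + \<delta> * real k) ^ t) = (if t = m then fact m * \<delta> ^ m else 0))"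
proof (induction m)
  case 0
  show ?case by (rule exI[of _ "\<lambda>_. 1"]) simp
next
  case (Suc m)
  then obtain b :: "nat \<Rightarrow> real" where b1: "(\<Sum>k\<le>m. \<bar>b k\<bar>) \<le> 2 ^ m"
    and b2: "\<And>w t. t \<le> m \<Longrightarrow>
      (\<Sum>k\<le>m. b k * (w + \<delta> * real k) ^ t) = (if t = m then fact m * \<delta> ^ m else 0)"
    by blast
  \<comment> \<open>The old weights moved one grid point to the right, and the old weights in place,
    both padded with zero; their difference gives the weights of the next difference.\<close>
  define b1' where "b1' = (\<lambda>k. if k = 0 then 0 else b (k - 1))"
  define b2' where "b2' = (\<lambda>k. if k \<le> m then b k else 0)"
  have s1: "(\<Sum>k\<le>Suc m. h (b1' k) * g k) = (\<Sum>k\<le>m. h (b k) * g (Suc k))" if "h 0 = 0"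
    for g h :: "_ \<Rightarrow> real"
    by (subst sum.atMost_Suc_shift) (simp add: b1'_def that)
  have s2: "(\<Sum>k\<le>Suc m. h (b2' k) * g k) = (\<Sum>k\<le>m. h (b k) * g k)" if "h 0 = 0"
    for g h :: "_ \<Rightarrow> real"
    by (subst sum.atMost_Suc) (simp add: b2'_def that)
  have "(\<Sum>k\<le>Suc m. \<bar>b1' k - b2' k\<bar>) \<le> (\<Sum>k\<le>Suc m. \<bar>b1' k\<bar> * 1) + (\<Sum>k\<le>Suc m. \<bar>b2' k\<bar> * 1)"
    unfolding sum.distrib[symmetric] by (intro sum_mono) auto
  also have "\<dots> \<le> 2 ^ Suc m"
    using b1 s1[of abs "\<lambda>_. 1"] s2[of abs "\<lambda>_. 1"] by simp
  finally have *: "(\<Sum>k\<le>Suc m. \<bar>b1' k - b2' k\<bar>) \<le> 2 ^ Suc m" .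
  have "(\<Sum>k\<le>Suc m. (b1' k - b2' k) * (w + \<delta> * real k) ^ t)
      = (if t = Suc m then fact (Suc m) * \<delta> ^ Suc m else 0)" if t: "t \<le> Suc m" for w t
  proof -
    have "(\<Sum>k\<le>Suc m. (b1' k - b2' k) * (w + \<delta> * real k) ^ t)
        = (\<Sum>k\<le>m. b k * (w + \<delta> * real (Suc k)) ^ t) - (\<Sum>k\<le>m. b k * (w + \<delta> * real k) ^ t)"
      using s1[of "\<lambda>x. x" "\<lambda>k. (w + \<delta> * real k) ^ t"] s2[of "\<lambda>x. x" "\<lambda>k. (w + \<delta> * real k) ^ t"]
      by (simp only: left_diff_distrib sum_subtractf)
    also have "\<dots> = (\<Sum>k\<le>m. b k * (\<Sum>j<t. real (t choose j) * (w + \<delta> * real k) ^ j * \<delta> ^ (t - j)))"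
    proof -
      have "b k * (w + \<delta> * real (Suc k)) ^ t - b k * (w + \<delta> * real k) ^ t
          = b k * (\<Sum>j<t. real (t choose j) * (w + \<delta> * real k) ^ j * \<delta> ^ (t - j))" for k
      proof -
        have "w + \<delta> * real (Suc k) = (w + \<delta> * real k) + \<delta>" by (simp add: algebra_simps)
        then have "(w + \<delta> * real (Suc k)) ^ t
            = (\<Sum>j\<le>t. real (t choose j) * (w + \<delta> * real k) ^ j * \<delta> ^ (t - j))"
          by (simp only: binomial_ring)
        also have "\<dots> = (\<Sum>j<t. real (t choose j) * (w + \<delta> * real k) ^ j * \<delta> ^ (t - j)) + (w + \<delta> * real k) ^ t"
          by (simp flip: lessThan_Suc_atMost)
        finally show ?thesis by (simp add: algebra_simps)
      qed
      then show ?thesis by (simp only: sum_subtractf[symmetric])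
    qed
    also have "\<dots> = (\<Sum>j<t. real (t choose j) * \<delta> ^ (t - j) * (\<Sum>k\<le>m. b k * (w + \<delta> * real k) ^ j))"
      unfolding sum_distrib_left by (subst sum.swap) (simp add: mult_ac)
    \<comment> \<open>The induction hypothesis kills every term with \<open>j < m\<close>, so only
      \<open>t = Suc m\<close>, \<open>j = m\<close> contributes; the binomial coefficient
      \<open>Suc m\<close> completes the factorial.\<close>
    also have "\<dots> = (\<Sum>j<t. real (t choose j) * \<delta> ^ (t - j) * (if j = m then fact m * \<delta> ^ m else 0))"
      using t by (intro sum.cong) (auto simp: b2)
    also have "\<dots> = (if t = Suc m then fact (Suc m) * \<delta> ^ Suc m else 0)"
      using t by (auto simp: if_distrib mult_ac cong: if_cong)
    finally show ?thesis .
  qed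
  with * show ?case by (intro exI[of _ "\<lambda>k. b1' k - b2' k"]) blast
qed

section \<open>Counting multi-indices and bounding homogeneous parts\<close>

text \<open>Every entry of \<open>s\<close> is at most \<open>l\<close>, which leaves
  \<open>Suc l ^ CARD('n)\<close> choices. The cruder exponential bound can be absorbed into a
  geometric ratio.\<close>

lemma finite_multi_degree: "finite {s :: 'n::finite \<Rightarrow> nat. multi_degree s = l}"
  and card_multi_degree: "card {s :: 'n::finite \<Rightarrow> nat. multi_degree s = l} \<le> 2 ^ (CARD('n) * l)"
proof -
  have sub: "{s :: 'n \<Rightarrow> nat. multi_degree s = l} \<subseteq> PiE UNIV (\<lambda>_. {..l})"
    by (auto simp: multi_degree_def intro: member_le_sum)
  have fin: "finite (PiE (UNIV :: 'n set) (\<lambda>_. {..l}))"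
    by (intro finite_PiE) auto
  show "finite {s :: 'n \<Rightarrow> nat. multi_degree s = l}"
    using sub fin by (rule finite_subset)
  have "card {s :: 'n \<Rightarrow> nat. multi_degree s = l} \<le> card (PiE (UNIV :: 'n set) (\<lambda>_. {..l}))"
    using fin sub by (rule card_mono)
  also have "\<dots> = Suc l ^ CARD('n)"
    by (simp add: card_PiE)
  also have "\<dots> \<le> (2 ^ l) ^ CARD('n)"
    by (intro power_mono) (use less_exp[of l] in \<open>auto simp: Suc_le_eq\<close>)
  also have "\<dots> = 2 ^ (CARD('n) * l)"
    by (simp add: mult.commute flip: power_mult)
  finally show "card {s :: 'n \<Rightarrow> nat. multi_degree s = l} \<le> 2 ^ (CARD('n) * l)" .
qed

lemma abs_multi_power_le: "\<bar>multi_power z s\<bar> \<le> norm z ^ multi_degree s"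
proof -
  have "\<bar>multi_power z s\<bar> = (\<Prod>i\<in>UNIV. \<bar>vec_nth z i\<bar> ^ s i)"
    by (simp add: multi_power_def abs_prod power_abs)
  also have "\<dots> \<le> (\<Prod>i\<in>UNIV. norm z ^ s i)"
    by (intro prod_mono) (auto intro: power_mono component_le_norm_cart)
  also have "\<dots> = norm z ^ multi_degree s"
    by (simp add: multi_degree_def power_sum)
  finally show ?thesis .
qed

lemma multi_power_scaleR: "multi_power (t *\<^sub>R z) s = t ^ multi_degree s * multi_power z s"
  by (simp add: multi_power_def multi_degree_def power_mult_distrib prod.distrib power_sum)

lemma homogeneous_part_scaleR: "homogeneous_part a l (t *\<^sub>R z) = t ^ l * homogeneous_part a l z"
  by (simp add: homogeneous_part_def multi_power_scaleR sum_distrib_left mult_ac)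

lemma homogeneous_part_sum:
  "homogeneous_part (\<lambda>s. \<Sum>i\<in>I. N i * c i s) l z = (\<Sum>i\<in>I. N i * homogeneous_part (c i) l z)"
  unfolding homogeneous_part_def sum_distrib_left sum_distrib_right
  by (subst sum.swap) (simp add: mult_ac)

lemma homogeneous_part_diff:
  "homogeneous_part (\<lambda>s. a s - b s) l z = homogeneous_part a l z - homogeneous_part b l z"
  by (simp add: homogeneous_part_def left_diff_distrib sum_subtractf)

lemma sums_homogeneous_part_sum:
  assumes "\<And>i. i \<in> I \<Longrightarrow> (\<lambda>l. homogeneous_part (c i) l z) sums g i"
  shows "(\<lambda>l. homogeneous_part (\<lambda>s. \<Sum>i\<in>I. N i * c i s) l z) sums (\<Sum>i\<in>I. N i * g i)"
  unfolding homogeneous_part_sum by (intro sums_sum sums_mult assms)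

text \<open>The number of monomials of degree \<open>l\<close> grows at most exponentially and so
  only enlarges the ratio. Geometric bounds on coefficients thus make the grouped series converge
  near 0.\<close>

lemma abs_homogeneous_part_le:
  fixes z :: "real^'n"
  assumes "0 < K" and a: "\<And>s. \<bar>a s\<bar> \<le> M * K ^ multi_degree s"
  shows "\<bar>homogeneous_part a l z\<bar> \<le> M * (2 ^ CARD('n) * K * norm z) ^ l"
proof -
  have "0 \<le> M" using a[of "\<lambda>_. 0"] by (auto simp: multi_degree_def)
  have "\<bar>homogeneous_part a l z\<bar> \<le> (\<Sum>s | multi_degree s = l. \<bar>a s * multi_power z s\<bar>)"
    unfolding homogeneous_part_def by (rule sum_abs)
  also have "\<dots> \<le> (\<Sum>s::'n \<Rightarrow> nat | multi_degree s = l. (M * K ^ l) * norm z ^ l)"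
    unfolding abs_mult using a abs_multi_power_le[of z] \<open>0 < K\<close> \<open>0 \<le> M\<close>
    by (intro sum_mono mult_mono) auto
  also have "\<dots> = real (card {s::'n \<Rightarrow> nat. multi_degree s = l}) * (M * K ^ l * norm z ^ l)"
    by simp
  also have "\<dots> \<le> real (2 ^ (CARD('n) * l)) * (M * K ^ l * norm z ^ l)"
    using card_multi_degree[where 'n = 'n, of l] \<open>0 < K\<close> \<open>0 \<le> M\<close>
    by (intro mult_right_mono) (auto simp: of_nat_le_iff simp del: of_nat_power)
  also have "\<dots> = M * (2 ^ CARD('n) * K * norm z) ^ l"
    by (simp add: power_mult_distrib mult_ac flip: power_mult)
  finally show ?thesis .
qed

lemma continuous_on_homogeneous_part: "continuous_on S (homogeneous_part a l)"
  unfolding homogeneous_part_def multi_power_def by (intro continuous_intros)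

text \<open>A single term of the exponential series; it serves as a Stirling-type lower bound for
  the factorial.\<close>

lemma power_le_fact_mult_exp:
  fixes x :: real
  assumes "0 \<le> x"
  shows "x ^ m \<le> fact m * exp x"
proof -
  have "(\<Sum>k\<in>{m}. inverse (fact k) * x ^ k) \<le> (\<Sum>k. inverse (fact k) * x ^ k)"
    by (rule sum_le_suminf[OF summable_exp]) (use assms in auto)
  also have "\<dots> = exp x" by (simp add: exp_def)
  finally show ?thesis by (simp add: field_simps)
qed

text \<open>A mixed finite difference of order \<open>s\<close> annihilates every monomial of degree
  \<open>multi_degree s\<close> except the one with exponent \<open>s\<close>, whatever the base point. So the coefficient is
  controlled by the values of the homogeneous part on a grid inside an arbitrary ball; \<open>fact (s i)\<close>
  outweighs the small mesh size.\<close>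
lemma abs_coeff_le:
  fixes a :: "('n::finite \<Rightarrow> nat) \<Rightarrow> real"
  assumes "0 < \<rho>"
    and bound: "\<And>z. norm (z - w) < \<rho> \<Longrightarrow> \<bar>homogeneous_part a (multi_degree s) z\<bar> \<le> M"
  shows "\<bar>a s\<bar> \<le> (M * exp (real CARD('n))) * (2 * exp (real CARD('n)) / \<rho>) ^ multi_degree s"
proof -
  define l where "l = multi_degree s"
  \<comment> \<open>Grid points are displaced by at most \<delta> times the degree \<open>l\<close>,
    so this mesh keeps the grid inside the ball; \<open>Suc l\<close> also covers
    \<open>l = 0\<close>.\<close>
  define \<delta> where "\<delta> = \<rho> / real (Suc l)"
  have \<delta>: "0 < \<delta>" "\<delta> * real l < \<rho>"
    using \<open>0 < \<rho>\<close> by (auto simp: \<delta>_def field_simps)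
  have M: "0 \<le> M" using bound[of w] \<open>0 < \<rho>\<close> by force
  define Q where "Q = (\<lambda>m (b::nat \<Rightarrow> real). (\<Sum>k\<le>m. \<bar>b k\<bar>) \<le> 2 ^ m \<and>
    (\<forall>w t. t \<le> m \<longrightarrow> (\<Sum>k\<le>m. b k * (w + \<delta> * real k) ^ t) = (if t = m then fact m * \<delta> ^ m else 0)))"
  have "\<forall>i. \<exists>b. Q (s i) b"
    unfolding Q_def by (intro allI finite_difference)
  from choice[OF this] obtain b where "\<forall>i. Q (s i) (b i)" ..
  then have b1: "\<And>i. (\<Sum>k\<le>s i. \<bar>b i k\<bar>) \<le> 2 ^ s i"
    and b2: "\<And>i w t. t \<le> s i \<Longrightarrow>
      (\<Sum>k\<le>s i. b i k * (w + \<delta> * real k) ^ t) = (if t = s i then fact (s i) * \<delta> ^ s i else 0)"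
    unfolding Q_def by simp_all
  define G where "G = PiE (UNIV :: 'n set) (\<lambda>i. {..s i})"
  define W where "W = (\<lambda>k. \<Prod>i\<in>UNIV. b i (k i))"
  define pt where "pt = (\<lambda>k. w + \<delta> *\<^sub>R (\<chi> i. real (k i)))"
  have pt_in: "norm (pt k - w) < \<rho>" if "k \<in> G" for k
  proof -
    have "norm (pt k - w) \<le> \<delta> * (\<Sum>i\<in>UNIV. real (k i))"
      using \<delta> norm_le_l1_cart[of "\<chi> i. real (k i)"] by (simp add: pt_def)
    also have "(\<Sum>i\<in>UNIV. real (k i)) \<le> (\<Sum>i\<in>UNIV. real (s i))"
      using that by (intro sum_mono) (auto simp: G_def PiE_iff)
    also have "\<dots> = real l" by (simp add: l_def multi_degree_def)
    finally show ?thesis using \<delta> by (simp add: mult_left_mono)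
  qed
  have mono: "(\<Sum>k\<in>G. W k * multi_power (pt k) t)
      = (if t = s then (\<Prod>i\<in>UNIV. fact (s i)) * \<delta> ^ l else 0)" if t: "multi_degree t = l" for t
  proof -
    have "(\<Sum>k\<in>G. W k * multi_power (pt k) t)
        = (\<Sum>k\<in>G. \<Prod>i\<in>UNIV. b i (k i) * (vec_nth w i + \<delta> * real (k i)) ^ t i)"
      by (simp add: W_def multi_power_def pt_def prod.distrib)
    also have "\<dots> = (\<Prod>i\<in>UNIV. \<Sum>k\<le>s i. b i k * (vec_nth w i + \<delta> * real k) ^ t i)"
      unfolding G_def by (subst prod_sum_PiE) auto
    also have "\<dots> = (if t = s then (\<Prod>i\<in>UNIV. fact (s i)) * \<delta> ^ l else 0)"
    proof (cases "t = s")
      case True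
      then show ?thesis
        by (simp add: b2 prod.distrib l_def multi_degree_def power_sum)
    next
      case False
      \<comment> \<open>Two distinct multi-indices of equal degree: some entry of \<open>t\<close>
        is below that of \<open>s\<close>, and the difference in this coordinate vanishes.\<close>
      have "\<exists>i. t i < s i"
      proof (rule ccontr)
        assume "\<nexists>i. t i < s i"
        then have le: "\<And>i. s i \<le> t i" by (simp add: not_less)
        obtain i where "t i \<noteq> s i" using False by (auto simp: fun_eq_iff)
        then have "s i < t i" using le[of i] by simp
        then have "(\<Sum>i\<in>UNIV. s i) < (\<Sum>i\<in>UNIV. t i)"
          using le by (intro sum_strict_mono_ex1) auto
        then show False using t by (simp add: l_def multi_degree_def)
      qed
      then obtain i where "t i < s i" by blast
      then have "(\<Sum>k\<le>s i. b i k * (vec_nth w i + \<delta> * real k) ^ t i) = 0"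
        by (simp add: b2)
      then show ?thesis
        using False by (auto intro!: prod_zero)
    qed
    finally show ?thesis .
  qed
  have "(\<Sum>k\<in>G. W k * homogeneous_part a l (pt k))
      = (\<Sum>t | multi_degree t = l. a t * (\<Sum>k\<in>G. W k * multi_power (pt k) t))"
    unfolding homogeneous_part_def sum_distrib_left by (subst sum.swap) (simp add: mult_ac)
  also have "\<dots> = (\<Sum>t | multi_degree t = l. if t = s then a s * ((\<Prod>i\<in>UNIV. fact (s i)) * \<delta> ^ l) else 0)"
    by (intro sum.cong) (auto simp: mono)
  also have "\<dots> = a s * ((\<Prod>i\<in>UNIV. fact (s i)) * \<delta> ^ l)"
    by (simp add: finite_multi_degree l_def)
  finally have "\<bar>a s\<bar> * ((\<Prod>i\<in>UNIV. fact (s i)) * \<delta> ^ l) = \<bar>\<Sum>k\<in>G. W k * homogeneous_part a l (pt k)\<bar>"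
    using \<delta> by (simp add: abs_mult abs_prod)
  also have "\<dots> \<le> (\<Sum>k\<in>G. \<bar>W k\<bar> * M)"
    using bound pt_in by (intro order.trans[OF sum_abs] sum_mono)
      (auto simp: abs_mult l_def intro!: mult_left_mono)
  also have "\<dots> = M * (\<Prod>i\<in>UNIV. \<Sum>k\<le>s i. \<bar>b i k\<bar>)"
    unfolding G_def W_def by (subst prod_sum_PiE) (auto simp: abs_prod sum_distrib_left mult.commute)
  also have "\<dots> \<le> M * (\<Prod>i\<in>UNIV. 2 ^ s i)"
    using M b1 by (intro mult_left_mono prod_mono) (auto simp: sum_nonneg)
  also have "\<dots> = M * 2 ^ l" by (simp add: l_def multi_degree_def power_sum)
  finally have 1: "\<bar>a s\<bar> * ((\<Prod>i\<in>UNIV. fact (s i)) * \<delta> ^ l) \<le> M * 2 ^ l" .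
  \<comment> \<open>Splitting \<open>Suc l ^ l\<close> over the coordinates and comparing with
    factorials cancels the power of the mesh, up to an exponential in \<open>l\<close>.\<close>
  have "(\<Prod>i\<in>UNIV. real (Suc l) ^ s i) \<le> (\<Prod>i\<in>(UNIV::'n set). fact (s i) * exp (real (Suc l)))"
    by (intro prod_mono conjI power_le_fact_mult_exp) auto
  then have 2: "real (Suc l) ^ l \<le> (\<Prod>i\<in>UNIV. fact (s i)) * exp (real (Suc l)) ^ CARD('n)"
    by (simp add: prod.distrib l_def multi_degree_def power_sum del: of_nat_Suc)
  have "\<bar>a s\<bar> * \<rho> ^ l = \<bar>a s\<bar> * \<delta> ^ l * real (Suc l) ^ l"
    by (simp add: \<delta>_def power_divide del: of_nat_Suc)
  also have "\<dots> \<le> \<bar>a s\<bar> * \<delta> ^ l * ((\<Prod>i\<in>UNIV. fact (s i)) * exp (real (Suc l)) ^ CARD('n))"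
    using 2 \<delta> by (intro mult_left_mono) auto
  also have "\<dots> = \<bar>a s\<bar> * ((\<Prod>i\<in>UNIV. fact (s i)) * \<delta> ^ l) * exp (real (Suc l)) ^ CARD('n)"
    by (simp only: mult_ac)
  also have "\<dots> \<le> M * 2 ^ l * exp (real (Suc l)) ^ CARD('n)"
    using 1 by (intro mult_right_mono) auto
  also have "exp (real (Suc l)) ^ CARD('n) = exp (real CARD('n)) * exp (real CARD('n)) ^ l"
    by (simp add: algebra_simps flip: exp_of_nat_mult exp_add)
  finally have "\<bar>a s\<bar> * \<rho> ^ l \<le> M * 2 ^ l * (exp (real CARD('n)) * exp (real CARD('n)) ^ l)" .
  then have "\<bar>a s\<bar> \<le> M * 2 ^ l * (exp (real CARD('n)) * exp (real CARD('n)) ^ l) / \<rho> ^ l"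
    using \<open>0 < \<rho>\<close> by (subst pos_le_divide_eq) auto
  then show ?thesis
    by (simp add: l_def power_divide power_mult_distrib mult_ac)
qed

section \<open>Uniqueness and growth of coefficients\<close>

text \<open>Once the lower coefficients vanish, the series can be divided by \<open>t ^ l\<close>,
  and \<open>c l\<close> is its limit at 0.\<close>

lemma eq_zero_if_sums_zero:
  fixes c :: "nat \<Rightarrow> real"
  assumes "\<And>t. norm t < 1 \<Longrightarrow> (\<lambda>l. c l * t ^ l) sums 0"
  shows "c l = 0"
proof (induction l rule: less_induct)
  case (less l)
  have "(\<lambda>n. c (n + l) * t ^ n) sums 0" if "t \<noteq> 0" "norm t < 1" for t
  proof -
    have "(\<lambda>n. c (n + l) * t ^ (n + l)) sums (0 - (\<Sum>i<l. c i * t ^ i))"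
      using assms[OF that(2)] by (rule sums_split_initial_segment)
    then have "(\<lambda>n. c (n + l) * t ^ (n + l)) sums 0"
      using less by simp
    then have "(\<lambda>n. c (n + l) * t ^ (n + l) / t ^ l) sums (0 / t ^ l)"
      by (rule sums_divide)
    then show ?thesis using that by (simp add: power_add)
  qed
  then have "((\<lambda>_. 0) \<longlongrightarrow> c (0 + l)) (at (0::real))"
    by (intro powser_limit_0_strong[of 1]) auto
  then show ?case by (simp add: tendsto_const_iff)
qed

text \<open>Along the line through 0 and \<open>z\<close> the series is an ordinary power series in
  \<open>t\<close>, so every homogeneous part vanishes on the ball; \<open>abs_coeff_le\<close> with
  bound 0 then annihilates each coefficient.\<close>

lemma coeff_eq_zero:
  fixes a :: "('n::finite \<Rightarrow> nat) \<Rightarrow> real"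
  assumes "0 < r" and sums: "\<And>z. norm z < r \<Longrightarrow> (\<lambda>l. homogeneous_part a l z) sums 0"
  shows "a s = 0"
proof -
  have "homogeneous_part a l z = 0" if "norm z < r" for l z
  proof (rule eq_zero_if_sums_zero)
    fix t :: real assume "norm t < 1"
    then have "norm (t *\<^sub>R z) \<le> norm z"
      by (simp add: mult_left_le_one_le)
    then have "(\<lambda>l. homogeneous_part a l (t *\<^sub>R z)) sums 0"
      using that by (intro sums) auto
    then show "(\<lambda>l. homogeneous_part a l z * t ^ l) sums 0"
      by (simp add: homogeneous_part_scaleR mult.commute)
  qed
  then have "\<bar>a s\<bar> \<le> (0 * exp (real CARD('n))) * (2 * exp (real CARD('n)) / r) ^ multi_degree s"
    using \<open>0 < r\<close> by (intro abs_coeff_le[where w = 0]) auto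
  then show ?thesis by simp
qed

text \<open>Convergence of the series grouped by degree bounds the homogeneous parts only pointwise;
  Baire's theorem makes the bound uniform on some ball, whose centre is out of our control.\<close>
lemma homogeneous_part_bounded:
  fixes a :: "('n::finite \<Rightarrow> nat) \<Rightarrow> real"
  assumes "0 < r" and summable: "\<And>z. norm z < r \<Longrightarrow> summable (\<lambda>l. homogeneous_part a l z)"
  shows "\<exists>w \<rho> M. 0 < \<rho> \<and> (\<forall>l z. norm (z - w) < \<rho> \<longrightarrow> \<bar>homogeneous_part a l z\<bar> \<le> M)"
proof -
  define T where "T = (\<lambda>n. {z :: real^'n. \<exists>l. real n < \<bar>homogeneous_part a l z\<bar>})"
  have op: "open (T n)" for n
  proof -
    have "open {z :: real^'n. real n < \<bar>homogeneous_part a l z\<bar>}" for l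
      by (intro open_Collect_less continuous_intros continuous_on_homogeneous_part)
    moreover have "T n = (\<Union>l. {z. real n < \<bar>homogeneous_part a l z\<bar>})"
      by (auto simp: T_def)
    ultimately show ?thesis by auto
  qed
  \<comment> \<open>The terms of a convergent series are bounded, so no point of the ball belongs to
    every \<open>T n\<close>.\<close>
  have disj: "ball 0 r \<inter> \<Inter>(range T) = {}"
  proof (rule ccontr)
    assume "ball 0 r \<inter> \<Inter>(range T) \<noteq> {}"
    then obtain z where z: "norm z < r" "\<forall>n. z \<in> T n" by auto
    have "Bseq (\<lambda>l. homogeneous_part a l z)"
      using summable[OF z(1)] by (intro convergent_imp_Bseq) (auto simp: convergent_def dest: summable_LIMSEQ_zero)
    then obtain B where B: "\<forall>l. \<bar>homogeneous_part a l z\<bar> \<le> B"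
      by (auto simp: Bseq_def)
    obtain n where "B < real n" using reals_Archimedean2 by blast
    moreover obtain l where "real n < \<bar>homogeneous_part a l z\<bar>"
      using z(2) by (auto simp: T_def)
    ultimately show False using B[rule_format, of l] by linarith
  qed
  \<comment> \<open>Otherwise Baire's theorem would make the intersection of the \<open>T n\<close>
    dense and let it meet the ball. A point outside some \<open>closure (T n)\<close> has a
    neighbourhood on which \<open>n\<close> bounds all homogeneous parts at once.\<close>
  have "\<not> (\<forall>n. closure (T n) = UNIV)"
  proof
    assume "\<forall>n. closure (T n) = UNIV"
    then have "UNIV \<subseteq> closure (\<Inter>(range T))"
      using op by (intro Baire) auto
    moreover have "0 \<in> ball (0 :: real^'n) r" using \<open>0 < r\<close> by simp
    moreover have "ball 0 r \<inter> closure (\<Inter>(range T)) = {}"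
      using disj open_Int_closure_eq_empty[of "ball 0 r" "\<Inter>(range T)"] by simp
    ultimately show False by blast
  qed
  then obtain n w where "w \<notin> closure (T n)" by auto
  then obtain \<rho> where "0 < \<rho>" and \<rho>: "ball w \<rho> \<subseteq> - closure (T n)"
    using open_contains_ball[of "- closure (T n)"] by auto
  show ?thesis
  proof (intro exI conjI allI impI)
    show "0 < \<rho>" by fact
    fix l z assume "norm (z - w) < \<rho>"
    then have "z \<in> ball w \<rho>" by (simp add: dist_norm norm_minus_commute)
    then have "z \<notin> T n" using \<rho> closure_subset by blast
    then show "\<bar>homogeneous_part a l z\<bar> \<le> real n" by (auto simp: T_def not_less)
  qed
qed

text \<open>The ball obtained from Baire's theorem may lie anywhere, which suffices since the bound
  in \<open>abs_coeff_le\<close> does not depend on the centre.\<close>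

lemma coeff_geometric_bound:
  fixes a :: "('n::finite \<Rightarrow> nat) \<Rightarrow> real"
  assumes "0 < r" and summable: "\<And>z. norm z < r \<Longrightarrow> summable (\<lambda>l. homogeneous_part a l z)"
  shows "\<exists>M K. 0 < K \<and> (\<forall>s. \<bar>a s\<bar> \<le> M * K ^ multi_degree s)"
proof -
  obtain w \<rho> M where *: "0 < \<rho>" "\<forall>l z. norm (z - w) < \<rho> \<longrightarrow> \<bar>homogeneous_part a l z\<bar> \<le> M"
    using homogeneous_part_bounded[OF assms] by blast
  show ?thesis
    using abs_coeff_le[of \<rho> w a _ M] *
    by (intro exI[of _ "M * exp (real CARD('n))"] exI[of _ "2 * exp (real CARD('n)) / \<rho>"]) auto
qed

section \<open>Termwise differentiation\<close>

text \<open>The coefficients of the formal partial derivative in direction \<open>i\<close>, indexed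
  by the exponent after differentiation.\<close>

definition partial_coeffs :: "'n \<Rightarrow> (('n \<Rightarrow> nat) \<Rightarrow> real) \<Rightarrow> ('n \<Rightarrow> nat) \<Rightarrow> real" where
  "partial_coeffs i a s = real (Suc (s i)) * a (s(i := Suc (s i)))"

lemma multi_degree_Suc: "multi_degree (s(i := Suc (s i))) = Suc (multi_degree s)"
  unfolding multi_degree_def by (subst (1 2) sum.remove[of _ i]) (auto intro!: sum.cong)

lemma multi_power_axis:
  "multi_power (z + t *\<^sub>R axis i 1) s
     = (vec_nth z i + t) ^ s i * (\<Prod>j\<in>UNIV - {i}. vec_nth z j ^ s j)"
  unfolding multi_power_def
  by (subst prod.remove[of _ i]) (auto simp: axis_def intro!: prod.cong)

text \<open>Monomials free of variable \<open>i\<close> drop out, and raising entry \<open>i\<close>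
  of a multi-index matches the remaining ones with those of degree \<open>l - 1\<close>. Degree 0 is
  split off because subtraction on naturals is truncated.\<close>

lemma homogeneous_part_has_partial_derivative:
  fixes z :: "real^'n"
  shows "((\<lambda>t. homogeneous_part a l (z + t *\<^sub>R axis i 1)) has_real_derivative
     (if l = 0 then 0 else homogeneous_part (partial_coeffs i a) (l - 1) (z + t *\<^sub>R axis i 1))) (at t)"
proof -
  define R where "R = (\<lambda>s. \<Prod>j\<in>UNIV - {i}. vec_nth z j ^ s j)"
  have R: "R (s(i := m)) = R s" for s m
    unfolding R_def by (intro prod.cong) auto
  have axis: "multi_power (z + t *\<^sub>R axis i 1) s = (vec_nth z i + t) ^ s i * R s" for t s
    by (simp add: R_def multi_power_axis)
  define d where "d = (\<lambda>s. a s * (real (s i) * (vec_nth z i + t) ^ (s i - 1) * R s))"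
  have "((\<lambda>t. homogeneous_part a l (z + t *\<^sub>R axis i 1)) has_real_derivative
      (\<Sum>s | multi_degree s = l. d s)) (at t)"
    unfolding homogeneous_part_def axis d_def
    by (auto intro!: derivative_eq_intros sum.cong)
  moreover have "(\<Sum>s | multi_degree s = l. d s)
      = (if l = 0 then 0 else homogeneous_part (partial_coeffs i a) (l - 1) (z + t *\<^sub>R axis i 1))"
  proof (cases l)
    case 0
    have "d s = 0" if "multi_degree s = 0" for s
      using that by (auto simp: d_def multi_degree_def)
    then show ?thesis using 0 by (auto intro: sum.neutral)
  next
    case (Suc m)
    have inj: "inj_on (\<lambda>s. s(i := Suc (s i))) {s. multi_degree s = m}"
    proof (rule inj_onI)
      fix s t :: "'n \<Rightarrow> nat" assume eq: "s(i := Suc (s i)) = t(i := Suc (t i))"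
      have "s j = t j" for j
        using fun_cong[OF eq, of j] by (auto split: if_splits)
      then show "s = t" by auto
    qed
    have img: "(\<lambda>s. s(i := Suc (s i))) ` {s. multi_degree s = m} = {s. multi_degree s = l \<and> s i \<noteq> 0}"
    proof (intro equalityI subsetI)
      fix s :: "'n \<Rightarrow> nat" assume s: "s \<in> {s. multi_degree s = l \<and> s i \<noteq> 0}"
      define s' where "s' = s(i := s i - 1)"
      have *: "s = s'(i := Suc (s' i))" using s by (auto simp: s'_def)
      moreover have "multi_degree s' = m"
        using s Suc multi_degree_Suc[of s' i] by (simp flip: *)
      ultimately show "s \<in> (\<lambda>s. s(i := Suc (s i))) ` {s. multi_degree s = m}" by blast
    qed (use Suc in \<open>auto simp: multi_degree_Suc\<close>)
    have "(\<Sum>s | multi_degree s = l. d s) = (\<Sum>s | multi_degree s = l \<and> s i \<noteq> 0. d s)"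
      by (rule sum.mono_neutral_right[OF finite_multi_degree]) (auto simp: d_def)
    also have "\<dots> = (\<Sum>s | multi_degree s = m. d (s(i := Suc (s i))))"
      unfolding img[symmetric] by (simp add: sum.reindex[OF inj])
    also have "\<dots> = homogeneous_part (partial_coeffs i a) m (z + t *\<^sub>R axis i 1)"
      unfolding homogeneous_part_def axis
      by (intro sum.cong) (simp_all add: d_def R partial_coeffs_def)
    finally show ?thesis using Suc by simp
  qed
  ultimately show ?thesis by simp
qed

lemma abs_partial_coeffs_le:
  assumes "0 < K" and a: "\<And>s. \<bar>a s\<bar> \<le> M * K ^ multi_degree s"
  shows "\<bar>partial_coeffs i a s\<bar> \<le> (M * K) * (2 * K) ^ multi_degree s"
proof -
  have M: "0 \<le> M" using a[of "\<lambda>_. 0"] by (auto simp: multi_degree_def)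
  have "s i \<le> multi_degree s" unfolding multi_degree_def by (rule member_le_sum) auto
  also have "\<dots> < 2 ^ multi_degree s" by (rule less_exp)
  finally have "real (Suc (s i)) \<le> 2 ^ multi_degree s"
    by (metis Suc_leI of_nat_le_iff of_nat_numeral of_nat_power)
  then have "real (Suc (s i)) * \<bar>a (s(i := Suc (s i)))\<bar> \<le> 2 ^ multi_degree s * (M * K ^ Suc (multi_degree s))"
    using a[of "s(i := Suc (s i))"] by (intro mult_mono) (auto simp: multi_degree_Suc)
  then show ?thesis
    by (simp add: partial_coeffs_def abs_mult power_mult_distrib mult_ac)
qed

text \<open>Close to 0 the series and its termwise derivatives are dominated by geometric series of
  ratio 1/2, so the Weierstrass test gives continuity and permits termwise differentiation along
  coordinate lines.\<close>

lemma local_power_series: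
  fixes a :: "('n::finite \<Rightarrow> nat) \<Rightarrow> real"
  assumes "0 < r" "0 < K" and a: "\<And>s. \<bar>a s\<bar> \<le> M * K ^ multi_degree s"
    and sums: "\<And>z. norm z < r \<Longrightarrow> (\<lambda>l. homogeneous_part a l z) sums f (q + z)"
  obtains \<rho> where "0 < \<rho>" "\<rho> \<le> r" "continuous_on (ball 0 \<rho>) (\<lambda>z. f (q + z))"
    and "\<And>i z. norm z < \<rho> \<Longrightarrow> summable (\<lambda>l. homogeneous_part (partial_coeffs i a) l z)"
    and "\<And>i z. norm z < \<rho> \<Longrightarrow> ((\<lambda>t. f (q + z + t *\<^sub>R axis i 1)) has_real_derivative
           (\<Sum>l. homogeneous_part (partial_coeffs i a) l z)) (at 0)"
proof -
  define C where "C = 2 ^ CARD('n) * (2 * K)"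
  have C: "0 < C" using \<open>0 < K\<close> by (simp add: C_def)
  define \<rho> where "\<rho> = min r (1 / (2 * C))"
  have \<rho>: "0 < \<rho>" "\<rho> \<le> r" using C \<open>0 < r\<close> by (auto simp: \<rho>_def)
  have M: "0 \<le> M" using a[of "\<lambda>_. 0"] by (auto simp: multi_degree_def)
  have Cz: "C * norm z \<le> 1 / 2" if "norm z < \<rho>" for z :: "real^'n"
    using that C by (auto simp: \<rho>_def field_simps)
  have b0: "\<bar>homogeneous_part a l z\<bar> \<le> M * (1 / 2) ^ l" if "norm z < \<rho>" for l z
  proof -
    have "2 ^ CARD('n) * K * norm z \<le> C * norm z"
      using \<open>0 < K\<close> by (intro mult_right_mono) (auto simp: C_def)
    then have "2 ^ CARD('n) * K * norm z \<le> 1 / 2" using Cz[OF that] by simp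
    then have "M * (2 ^ CARD('n) * K * norm z) ^ l \<le> M * (1 / 2) ^ l"
      using M \<open>0 < K\<close> by (intro mult_left_mono power_mono) auto
    then show ?thesis
      using abs_homogeneous_part_le[OF \<open>0 < K\<close> a, of l z] by simp
  qed
  have b1: "\<bar>homogeneous_part (partial_coeffs i a) l z\<bar> \<le> M * K * (1 / 2) ^ l" if "norm z < \<rho>" for i l z
  proof -
    have "M * K * (2 ^ CARD('n) * (2 * K) * norm z) ^ l \<le> M * K * (1 / 2) ^ l"
      using M \<open>0 < K\<close> Cz[OF that] by (intro mult_left_mono power_mono) (auto simp: C_def)
    then show ?thesis
      using abs_homogeneous_part_le[of "2 * K" "partial_coeffs i a" "M * K" l z]
        abs_partial_coeffs_le[OF \<open>0 < K\<close> a] \<open>0 < K\<close> by simp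
  qed
  have geom: "summable (\<lambda>l. B * (1 / 2 :: real) ^ l)" for B
    by (intro summable_mult summable_geometric) auto
  have sum1: "summable (\<lambda>l. homogeneous_part (partial_coeffs i a) l z)" if "norm z < \<rho>" for i z
    by (rule summable_comparison_test'[OF geom[of "M * K"], of 0]) (use b1[OF that] in simp)
  have "uniform_limit (ball 0 \<rho>) (\<lambda>n z. \<Sum>l<n. homogeneous_part a l z)
      (\<lambda>z. \<Sum>l. homogeneous_part a l z) sequentially"
    by (rule Weierstrass_m_test[OF _ geom[of M]]) (use b0 in auto)
  then have "continuous_on (ball 0 \<rho>) (\<lambda>z. \<Sum>l. homogeneous_part a l z)"
    by (rule uniform_limit_theorem[rotated])
       (auto intro!: always_eventually continuous_on_sum continuous_on_homogeneous_part)
  then have cont: "continuous_on (ball 0 \<rho>) (\<lambda>z. f (q + z))"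
    by (rule continuous_on_eq) (use sums \<rho> in \<open>auto simp: sums_iff\<close>)
  have deriv: "((\<lambda>t. f (q + z + t *\<^sub>R axis i 1)) has_real_derivative
           (\<Sum>l. homogeneous_part (partial_coeffs i a) l z)) (at 0)" if z: "norm z < \<rho>" for i z
  proof -
    \<comment> \<open>The parameters for which the coordinate line through \<open>z\<close> stays in
      the ball: an open convex set, as termwise differentiation requires.\<close>
    define S where "S = (\<lambda>t::real. z + t *\<^sub>R axis i 1) -` ball 0 \<rho>"
    define f' where "f' = (\<lambda>l t. if l = 0 then 0
      else homogeneous_part (partial_coeffs i a) (l - 1) (z + t *\<^sub>R axis i 1))"
    have opS: "open S" unfolding S_def
      by (intro open_vimage open_ball continuous_intros)
    have "convex S"
    proof (rule convexI)
      fix s t u v :: real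
      assume st: "s \<in> S" "t \<in> S" and uv: "0 \<le> u" "0 \<le> v" "u + v = 1"
      have "u *\<^sub>R (z + s *\<^sub>R axis i 1) + v *\<^sub>R (z + t *\<^sub>R axis i 1) \<in> ball 0 \<rho>"
        using st uv by (intro convexD[OF convex_ball]) (auto simp: S_def)
      also have "u *\<^sub>R (z + s *\<^sub>R axis i 1) + v *\<^sub>R (z + t *\<^sub>R axis i 1)
          = (u + v) *\<^sub>R z + (u * s + v * t) *\<^sub>R axis i 1"
        by (simp add: algebra_simps)
      finally show "u *\<^sub>R s + v *\<^sub>R t \<in> S" using uv by (simp add: S_def)
    qed
    have S0: "0 \<in> S" using z by (simp add: S_def)
    \<comment> \<open>The factor 2 pays for the shift from \<open>l\<close> to \<open>l - 1\<close>
      in the exponent of 1/2.\<close>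
    have "norm (f' l t) \<le> 2 * M * K * (1 / 2) ^ l" if "t \<in> S" for l t
      using b1[of "z + t *\<^sub>R axis i 1" i "l - 1"] that M \<open>0 < K\<close>
      by (cases l) (auto simp: f'_def S_def)
    then have ucv: "uniformly_convergent_on S (\<lambda>n t. \<Sum>l<n. f' l t)"
      by (intro Weierstrass_m_test'[OF _ geom[of "2 * M * K"]]) auto
    have sm: "summable (\<lambda>l. homogeneous_part a l (z + 0 *\<^sub>R axis i 1))"
      using sums z \<rho> by (auto simp: sums_iff)
    have int: "0 \<in> interior S" using opS S0 by (simp add: interior_open)
    have der: "((\<lambda>t. homogeneous_part a l (z + t *\<^sub>R axis i 1)) has_real_derivative f' l t) (at t within S)" for l t
      unfolding f'_def by (rule has_field_derivative_at_within[OF homogeneous_part_has_partial_derivative])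
    have "((\<lambda>t. \<Sum>l. homogeneous_part a l (z + t *\<^sub>R axis i 1)) has_real_derivative (\<Sum>l. f' l 0)) (at 0)"
      by (rule has_field_derivative_series'(2)[OF \<open>convex S\<close> der ucv S0 sm int])
    moreover have "(\<Sum>l. f' l 0) = (\<Sum>l. homogeneous_part (partial_coeffs i a) l z)"
    proof -
      have "(\<lambda>l. f' (Suc l) 0) sums (\<Sum>l. homogeneous_part (partial_coeffs i a) l z)"
        using summable_sums[OF sum1[OF z]] by (simp add: f'_def)
      then have "(\<lambda>l. f' l 0) sums (\<Sum>l. homogeneous_part (partial_coeffs i a) l z)"
        by (subst (asm) sums_Suc_iff) (simp add: f'_def)
      then show ?thesis by (simp add: sums_iff)
    qed
    moreover have "\<forall>\<^sub>F t in nhds 0. (\<Sum>l. homogeneous_part a l (z + t *\<^sub>R axis i 1)) = f (q + z + t *\<^sub>R axis i 1)"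
      using eventually_nhds_in_open[OF opS S0]
    proof eventually_elim
      case (elim t)
      then have "norm (z + t *\<^sub>R axis i 1) < r" using \<rho> by (simp add: S_def)
      then show ?case using sums by (simp add: sums_iff add.assoc)
    qed
    ultimately show ?thesis
      by (simp add: DERIV_cong_ev)
  qed
  show ?thesis
    by (rule that[OF \<rho> cont sum1 deriv])
qed

section \<open>Smoothness from local power series\<close>

text \<open>Coefficients and radius may vary with the point, and only convergence grouped by degree
  is asked; this class is stable under partial derivatives, which drives the induction on the order
  of smoothness.\<close>

definition locally_power_series :: "(real^'n) set \<Rightarrow> (real^'n \<Rightarrow> real) \<Rightarrow> bool" where
  "locally_power_series V f \<longleftrightarrow> (\<forall>q\<in>V. \<exists>a r. 0 < r \<and>
     (\<forall>z. norm z < r \<longrightarrow> (\<lambda>l. homogeneous_part a l z) sums f (q + z)))"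

text \<open>Stating the derivative through \<open>deriv\<close> provides one function on the whole
  of \<open>V\<close>, while the series and their radii are chosen point by point.\<close>

lemma locally_power_series_partial:
  assumes "locally_power_series V f" "q \<in> V"
  shows "isCont f q"
    and "\<exists>b \<rho>. 0 < \<rho> \<and> (\<forall>i z. norm z < \<rho> \<longrightarrow>
      ((\<lambda>t. f (q + z + t *\<^sub>R axis i 1)) has_real_derivative
         deriv (\<lambda>t. f (q + z + t *\<^sub>R axis i 1)) 0) (at 0) \<and>
      (\<lambda>l. homogeneous_part (b i) l z) sums deriv (\<lambda>t. f (q + z + t *\<^sub>R axis i 1)) 0)"
proof -
  obtain a r where r: "0 < r" and sums: "\<And>z. norm z < r \<Longrightarrow> (\<lambda>l. homogeneous_part a l z) sums f (q + z)"
    using assms unfolding locally_power_series_def by blast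
  have "\<exists>M K. 0 < K \<and> (\<forall>s. \<bar>a s\<bar> \<le> M * K ^ multi_degree s)"
    by (rule coeff_geometric_bound[OF r]) (use sums in \<open>auto simp: sums_iff\<close>)
  then obtain M K where K: "0 < K" and a: "\<And>s. \<bar>a s\<bar> \<le> M * K ^ multi_degree s"
    by blast
  obtain \<rho> where \<rho>: "0 < \<rho>" and cont: "continuous_on (ball 0 \<rho>) (\<lambda>z. f (q + z))"
    and summable: "\<And>i z. norm z < \<rho> \<Longrightarrow> summable (\<lambda>l. homogeneous_part (partial_coeffs i a) l z)"
    and deriv: "\<And>i z. norm z < \<rho> \<Longrightarrow> ((\<lambda>t. f (q + z + t *\<^sub>R axis i 1)) has_real_derivative
           (\<Sum>l. homogeneous_part (partial_coeffs i a) l z)) (at 0)"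
    using local_power_series[OF r K a sums] by metis
  have "isCont (\<lambda>z. f (q + z)) 0"
    using cont \<rho> by (simp add: continuous_on_eq_continuous_at)
  then have "isCont ((\<lambda>z. f (q + z)) \<circ> (\<lambda>y. y - q)) q"
    by (intro continuous_at_compose) auto
  then show "isCont f q" by (simp add: o_def)
  show "\<exists>b \<rho>. 0 < \<rho> \<and> (\<forall>i z. norm z < \<rho> \<longrightarrow>
      ((\<lambda>t. f (q + z + t *\<^sub>R axis i 1)) has_real_derivative
         deriv (\<lambda>t. f (q + z + t *\<^sub>R axis i 1)) 0) (at 0) \<and>
      (\<lambda>l. homogeneous_part (b i) l z) sums deriv (\<lambda>t. f (q + z + t *\<^sub>R axis i 1)) 0)"
  proof (intro exI conjI allI impI)
    fix i and z :: "real^'a" assume z: "norm z < \<rho>"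
    note eq = DERIV_imp_deriv[OF deriv[OF z, of i]]
    show "((\<lambda>t. f (q + z + t *\<^sub>R axis i 1)) has_real_derivative
         deriv (\<lambda>t. f (q + z + t *\<^sub>R axis i 1)) 0) (at 0)"
      unfolding eq by (rule deriv[OF z])
    show "(\<lambda>l. homogeneous_part (partial_coeffs i a) l z) sums deriv (\<lambda>t. f (q + z + t *\<^sub>R axis i 1)) 0"
      unfolding eq by (rule summable_sums[OF summable[OF z]])
  qed (rule \<rho>)
qed

lemma locally_power_series_imp_C_k:
  assumes "open V" "locally_power_series V f"
  shows "C_k k V f"
  using assms(2)
proof (induction k arbitrary: f)
  case (0 f)
  then show ?case
    using locally_power_series_partial(1) by (auto simp: continuous_on_eq_continuous_at[OF \<open>open V\<close>])
next
  case (Suc k f)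
  define g where "g = (\<lambda>i y. deriv (\<lambda>t. f (y + t *\<^sub>R axis i 1)) 0)"
  have *: "\<exists>b \<rho>. 0 < \<rho> \<and> (\<forall>i z. norm z < \<rho> \<longrightarrow>
      ((\<lambda>t. f (q + z + t *\<^sub>R axis i 1)) has_real_derivative g i (q + z)) (at 0) \<and>
      (\<lambda>l. homogeneous_part (b i) l z) sums g i (q + z))" if "q \<in> V" for q
    unfolding g_def using Suc.prems that by (rule locally_power_series_partial(2))
  have "((\<lambda>t. f (y + t *\<^sub>R axis i 1)) has_real_derivative g i y) (at 0)" if y: "y \<in> V" for i y
  proof -
    obtain b \<rho> where "0 < \<rho>" and \<rho>: "\<forall>i z. norm z < \<rho> \<longrightarrow>
      ((\<lambda>t. f (y + z + t *\<^sub>R axis i 1)) has_real_derivative g i (y + z)) (at 0) \<and>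
      (\<lambda>l. homogeneous_part (b i) l z) sums g i (y + z)"
      using *[OF y] by (elim exE conjE) (rule that)
    then show ?thesis using \<rho>[rule_format, of 0 i] by simp
  qed
  moreover have "locally_power_series V (g i)" for i
    unfolding locally_power_series_def
  proof
    fix q assume "q \<in> V"
    obtain b \<rho> where "0 < \<rho>" and \<rho>: "\<forall>i z. norm z < \<rho> \<longrightarrow>
      ((\<lambda>t. f (q + z + t *\<^sub>R axis i 1)) has_real_derivative g i (q + z)) (at 0) \<and>
      (\<lambda>l. homogeneous_part (b i) l z) sums g i (q + z)"
      using *[OF \<open>q \<in> V\<close>] by (elim exE conjE) (rule that)
    then show "\<exists>a r. 0 < r \<and> (\<forall>z. norm z < r \<longrightarrow> (\<lambda>l. homogeneous_part a l z) sums g i (q + z))"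
      by (intro exI[of _ "b i"] exI[of _ \<rho>]) simp
  qed
  moreover have "continuous_on V f"
    using Suc.prems locally_power_series_partial(1)
    by (auto simp: continuous_on_eq_continuous_at[OF \<open>open V\<close>])
  ultimately show ?case
    using Suc.IH by (auto intro!: exI[of _ g])
qed

section \<open>Dual points and the rank\<close>

text \<open>The pointwise counterpart of \<open>lin_indep_ae\<close>, suited to evaluation at
  individual points; \<open>lin_indep_ae\<close> implies it for finite index sets.\<close>

definition lin_indep_on :: "'i set \<Rightarrow> ('i \<Rightarrow> 'a \<Rightarrow> real) \<Rightarrow> 'a set \<Rightarrow> bool" where
  "lin_indep_on J f U \<longleftrightarrow> (\<forall>\<alpha>. (\<forall>x\<in>U. (\<Sum>j\<in>J. \<alpha> j * f j x) = 0) \<longrightarrow> (\<forall>j\<in>J. \<alpha> j = 0))"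

lemma lin_indep_onD:
  "lin_indep_on J f U \<Longrightarrow> (\<And>x. x \<in> U \<Longrightarrow> (\<Sum>j\<in>J. \<alpha> j * f j x) = 0) \<Longrightarrow> j \<in> J \<Longrightarrow> \<alpha> j = 0"
  unfolding lin_indep_on_def by blast

lemma lin_indep_aeD:
  assumes "lin_indep_ae I f U" "finite I" "AE x\<in>U in lebesgue. (\<Sum>s\<in>I. \<alpha> s * f s x) = 0" "s \<in> I"
  shows "\<alpha> s = 0"
  using assms unfolding lin_indep_ae_def by blast

lemma lin_indep_aeI:
  fixes f :: "'i \<Rightarrow> 'a::euclidean_space \<Rightarrow> real"
  assumes fin: "finite I"
    and *: "\<And>\<alpha> s. (AE x\<in>U in lebesgue. (\<Sum>s\<in>I. \<alpha> s * f s x) = 0) \<Longrightarrow> s \<in> I \<Longrightarrow> \<alpha> s = 0"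
  shows "lin_indep_ae I f U"
  unfolding lin_indep_ae_def
proof (intro allI impI ballI, elim conjE)
  fix J \<alpha> s
  assume J: "J \<subseteq> I" and ae: "AE x\<in>U in lebesgue. (\<Sum>s\<in>J. \<alpha> s * f s x) = 0" and s: "s \<in> J"
  have "(\<Sum>s\<in>I. (if s \<in> J then \<alpha> s else 0) * f s x) = (\<Sum>s\<in>J. \<alpha> s * f s x)" for x
    using J fin by (intro sum.mono_neutral_cong_right) auto
  then have "(if s \<in> J then \<alpha> s else 0) = 0"
    using ae s J by (intro *[of "\<lambda>s. if s \<in> J then \<alpha> s else 0"]) auto
  then show "\<alpha> s = 0"
    using s by simp
qed

lemma lin_indep_ae_imp_lin_indep_on:
  assumes "lin_indep_ae J f U" "finite J"
  shows "lin_indep_on J f U"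
  unfolding lin_indep_on_def
proof (intro allI impI ballI)
  fix \<alpha> j
  assume "\<forall>x\<in>U. (\<Sum>j\<in>J. \<alpha> j * f j x) = 0" "j \<in> J"
  then show "\<alpha> j = 0"
    using lin_indep_aeD[OF assms, of \<alpha> j] by simp
qed

text \<open>The functionals \<open>\<lambda>h. \<Sum>i\<in>J. N j i * h (x i)\<close> are dual to the functions \<open>f j\<close>, and the
  evaluations at the points \<open>x i\<close> are linearly independent on their span.\<close>
definition dual_system ::
  "'i set \<Rightarrow> ('i \<Rightarrow> 'a \<Rightarrow> real) \<Rightarrow> 'a set \<Rightarrow> ('i \<Rightarrow> 'a) \<Rightarrow> ('i \<Rightarrow> 'i \<Rightarrow> real) \<Rightarrow> bool" where
  "dual_system J f U x N \<longleftrightarrow> (\<forall>i\<in>J. x i \<in> U) \<and>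
     (\<forall>j\<in>J. \<forall>j'\<in>J. (\<Sum>i\<in>J. N j i * f j' (x i)) = of_bool (j = j')) \<and>
     (\<forall>\<alpha>. (\<forall>j\<in>J. (\<Sum>i\<in>J. \<alpha> i * f j (x i)) = 0) \<longrightarrow> (\<forall>i\<in>J. \<alpha> i = 0))"

text \<open>Induction on \<open>J\<close>: a new point \<open>u\<close> is chosen where
  \<open>f b\<close> differs from its interpolant at the old points, and the inverse matrix is
  extended by a block formula with pivot \<open>g u\<close>.\<close>

lemma dual_system_exists:
  fixes f :: "'i \<Rightarrow> 'a \<Rightarrow> real"
  assumes "finite J" "lin_indep_on J f U"
  shows "\<exists>x N. dual_system J f U x N"
  unfolding dual_system_def
  using assms
proof (induction J)
  case empty
  then show ?case by simp
next
  case (insert b J)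
  have "lin_indep_on J f U"
    unfolding lin_indep_on_def
  proof (intro allI impI ballI)
    fix \<alpha> j
    assume *: "\<forall>x\<in>U. (\<Sum>j\<in>J. \<alpha> j * f j x) = 0" and j: "j \<in> J"
    have "(\<Sum>j\<in>insert b J. (\<alpha>(b := 0)) j * f j x) = (\<Sum>j\<in>J. \<alpha> j * f j x)" for x
      using insert.hyps by (simp, intro sum.cong) auto
    then have "(\<alpha>(b := 0)) j = 0"
      using * j by (intro lin_indep_onD[OF insert.prems, of "\<alpha>(b := 0)" j]) auto
    then show "\<alpha> j = 0"
      using j insert.hyps by (auto split: if_splits)
  qed
  from insert.IH[OF this] obtain x and N :: "'i \<Rightarrow> 'i \<Rightarrow> real" where x: "\<forall>i\<in>J. x i \<in> U"
    and L: "\<forall>j\<in>J. \<forall>j'\<in>J. (\<Sum>i\<in>J. N j i * f j' (x i)) = of_bool (j = j')"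
    and T': "\<forall>\<alpha>. (\<forall>j\<in>J. (\<Sum>i\<in>J. \<alpha> i * f j (x i)) = 0) \<longrightarrow> (\<forall>i\<in>J. \<alpha> i = 0)"
    by blast
  have T: "\<forall>i\<in>J. \<alpha> i = 0" if "\<And>j. j \<in> J \<Longrightarrow> (\<Sum>i\<in>J. \<alpha> i * f j (x i)) = 0" for \<alpha>
    using T'[rule_format, OF that] by simp
  \<comment> \<open>\<open>ev\<close> holds the coefficients of the combination of the old functions
    that agrees with \<open>f b\<close> at the old points; \<open>g\<close> is the
    remainder.\<close>
  define ev where "ev = (\<lambda>j. \<Sum>i\<in>J. N j i * f b (x i))"
  define g where "g = (\<lambda>u. f b u - (\<Sum>j\<in>J. ev j * f j u))"
  have "\<exists>u\<in>U. g u \<noteq> 0"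
  proof (rule ccontr)
    assume *: "\<not> ?thesis"
    have "(\<Sum>j\<in>insert b J. (if j = b then 1 else - ev j) * f j u) = g u" for u
    proof -
      have "(\<Sum>j\<in>J. (if j = b then 1 else - ev j) * f j u) = (\<Sum>j\<in>J. - (ev j * f j u))"
        using insert.hyps by (intro sum.cong) auto
      then show ?thesis
        using insert.hyps by (simp add: g_def sum_negf)
    qed
    then have "(if b = b then 1 else - ev b) = 0"
      using * by (intro lin_indep_onD[OF insert.prems, of "\<lambda>j. if j = b then 1 else - ev j" b]) auto
    then show False by simp
  qed
  then obtain u where u: "u \<in> U" "g u \<noteq> 0" by blast
  \<comment> \<open>\<open>N\<close> is an inverse on the other side too: each row of the product
    minus the identity gives a relation among evaluations, which \<open>T\<close> forces to be
    trivial.\<close>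
  have R: "(\<Sum>j\<in>J. f j (x i0) * N j i) = of_bool (i = i0)" if "i0 \<in> J" "i \<in> J" for i0 i
  proof -
    have "\<forall>i\<in>J. (\<Sum>j\<in>J. f j (x i0) * N j i) - of_bool (i = i0) = 0"
    proof (rule T)
      fix j' assume j': "j' \<in> J"
      have "(\<Sum>i\<in>J. (\<Sum>j\<in>J. f j (x i0) * N j i) * f j' (x i))
          = (\<Sum>j\<in>J. f j (x i0) * (\<Sum>i\<in>J. N j i * f j' (x i)))"
        unfolding sum_distrib_left sum_distrib_right by (subst sum.swap) (simp add: mult_ac)
      also have "\<dots> = f j' (x i0)"
        using insert.hyps j' by (simp add: L if_distrib sum.delta)
      finally show "(\<Sum>i\<in>J. ((\<Sum>j\<in>J. f j (x i0) * N j i) - of_bool (i = i0)) * f j' (x i)) = 0"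
        using insert.hyps that by (simp add: left_diff_distrib sum_subtractf)
    qed
    then show ?thesis using that by auto
  qed
  have g0: "g (x i) = 0" if i: "i \<in> J" for i
  proof -
    have "(\<Sum>j\<in>J. ev j * f j (x i)) = (\<Sum>i'\<in>J. f b (x i') * (\<Sum>j\<in>J. f j (x i) * N j i'))"
      unfolding ev_def sum_distrib_left sum_distrib_right by (subst sum.swap) (simp add: mult_ac)
    also have "\<dots> = f b (x i)"
      using insert.hyps i by (simp add: R)
    finally show ?thesis by (simp add: g_def)
  qed
  define x' where "x' = x(b := u)"
  \<comment> \<open>\<open>Nb\<close> sends \<open>h\<close> to its interpolation remainder at
    \<open>u\<close>, divided by \<open>g u\<close>; \<open>N'\<close> corrects each old functional
    by its value \<open>ev j\<close> on \<open>f b\<close>.\<close>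
  define Nb where "Nb = (\<lambda>i. if i = b then 1 / g u else - (\<Sum>j\<in>J. f j u * N j i) / g u)"
  define N' where "N' = (\<lambda>j i. if j = b then Nb i else if i = b then - ev j / g u else N j i - ev j * Nb i)"
  have sum_x': "(\<Sum>i\<in>insert b J. \<alpha> i * f j (x' i)) = \<alpha> b * f j u + (\<Sum>i\<in>J. \<alpha> i * f j (x i))" for \<alpha> j
  proof -
    have "(\<Sum>i\<in>J. \<alpha> i * f j (x' i)) = (\<Sum>i\<in>J. \<alpha> i * f j (x i))"
      using insert.hyps by (intro sum.cong) (auto simp: x'_def)
    then show ?thesis using insert.hyps by (simp add: x'_def)
  qed
  have Nb_J: "(\<Sum>i\<in>J. Nb i * h i) = - (\<Sum>j\<in>J. f j u * (\<Sum>i\<in>J. N j i * h i)) / g u" for h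
  proof -
    have "(\<Sum>i\<in>J. Nb i * h i) = (\<Sum>i\<in>J. - (\<Sum>j\<in>J. f j u * N j i) / g u * h i)"
      using insert.hyps by (intro sum.cong) (auto simp: Nb_def)
    also have "\<dots> = - (\<Sum>i\<in>J. (\<Sum>j\<in>J. f j u * N j i) * h i) / g u"
      by (simp add: sum_negf flip: sum_divide_distrib)
    also have "(\<Sum>i\<in>J. (\<Sum>j\<in>J. f j u * N j i) * h i) = (\<Sum>j\<in>J. f j u * (\<Sum>i\<in>J. N j i * h i))"
      unfolding sum_distrib_left sum_distrib_right by (subst sum.swap) (simp add: mult_ac)
    finally show ?thesis .
  qed
  have Lb: "(\<Sum>i\<in>insert b J. Nb i * f j' (x' i)) = of_bool (b = j')" if "j' \<in> insert b J" for j'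
  proof (cases "j' = b")
    case True
    have "(\<Sum>j\<in>J. f j u * (\<Sum>i\<in>J. N j i * f b (x i))) = f b u - g u"
      by (simp add: g_def ev_def mult.commute)
    then show ?thesis
      unfolding sum_x' Nb_J using u True by (simp add: Nb_def field_simps)
  next
    case False
    then have "j' \<in> J" using that by simp
    then have "(\<Sum>j\<in>J. f j u * (\<Sum>i\<in>J. N j i * f j' (x i))) = f j' u"
      using insert.hyps by (simp add: L)
    then show ?thesis
      unfolding sum_x' Nb_J using u False by (simp add: Nb_def)
  qed
  have LJ: "(\<Sum>i\<in>insert b J. N' j i * f j' (x' i)) = of_bool (j = j')"
    if j: "j \<in> J" and j': "j' \<in> insert b J" for j j'
  proof -
    have jb: "j \<noteq> b" using j insert.hyps by auto
    have "(\<Sum>i\<in>insert b J. N' j i * f j' (x' i))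
        = - ev j * Nb b * f j' u + (\<Sum>i\<in>J. N' j i * f j' (x i))"
      unfolding sum_x' using jb by (simp add: N'_def Nb_def)
    also have "(\<Sum>i\<in>J. N' j i * f j' (x i)) = (\<Sum>i\<in>J. N j i * f j' (x i) - ev j * (Nb i * f j' (x i)))"
      using insert.hyps jb by (intro sum.cong) (auto simp: N'_def algebra_simps)
    also have "\<dots> = (\<Sum>i\<in>J. N j i * f j' (x i)) - ev j * (\<Sum>i\<in>J. Nb i * f j' (x i))"
      by (simp add: sum_subtractf sum_distrib_left)
    also have "- ev j * Nb b * f j' u + \<dots>
        = (\<Sum>i\<in>J. N j i * f j' (x i)) - ev j * (\<Sum>i\<in>insert b J. Nb i * f j' (x' i))"
      unfolding sum_x' by (simp add: algebra_simps)
    also have "\<dots> = of_bool (j = j')"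
      unfolding Lb[OF j'] using j j' jb by (cases "j' = b") (auto simp: ev_def L)
    finally show ?thesis .
  qed
  have "\<forall>i\<in>insert b J. x' i \<in> U"
    using x u insert.hyps by (auto simp: x'_def)
  moreover have "\<forall>j\<in>insert b J. \<forall>j'\<in>insert b J.
      (\<Sum>i\<in>insert b J. N' j i * f j' (x' i)) = of_bool (j = j')"
  proof (intro ballI)
    fix j j' assume "j \<in> insert b J" and j': "j' \<in> insert b J"
    then consider "j = b" | "j \<in> J" by blast
    then show "(\<Sum>i\<in>insert b J. N' j i * f j' (x' i)) = of_bool (j = j')"
    proof cases
      case 1
      have "N' b = Nb" by (simp add: N'_def)
      then show ?thesis using 1 Lb[OF j'] by simp
    qed (use LJ j' in blast)
  qed
  moreover have "\<forall>i\<in>insert b J. \<alpha> i = 0"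
    if *: "\<forall>j\<in>insert b J. (\<Sum>i\<in>insert b J. \<alpha> i * f j (x' i)) = 0" for \<alpha>
  proof -
    have eq: "\<alpha> b * f j u + (\<Sum>i\<in>J. \<alpha> i * f j (x i)) = 0" if "j \<in> insert b J" for j
      using * that unfolding sum_x' by blast
    \<comment> \<open>Since \<open>g\<close> vanishes at the old points, this combination of the
      relations isolates \<open>\<alpha> b * g u\<close>.\<close>
    have "\<alpha> b * g u + (\<Sum>i\<in>J. \<alpha> i * g (x i))
        = (\<alpha> b * f b u + (\<Sum>i\<in>J. \<alpha> i * f b (x i)))
          - (\<alpha> b * (\<Sum>j\<in>J. ev j * f j u) + (\<Sum>i\<in>J. \<alpha> i * (\<Sum>j\<in>J. ev j * f j (x i))))"
      by (simp add: g_def right_diff_distrib sum_subtractf)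
    also have "(\<Sum>i\<in>J. \<alpha> i * (\<Sum>j\<in>J. ev j * f j (x i))) = (\<Sum>j\<in>J. ev j * (\<Sum>i\<in>J. \<alpha> i * f j (x i)))"
      unfolding sum_distrib_left by (subst sum.swap) (simp add: mult_ac)
    also have "\<alpha> b * (\<Sum>j\<in>J. ev j * f j u) + \<dots>
        = (\<Sum>j\<in>J. ev j * (\<alpha> b * f j u + (\<Sum>i\<in>J. \<alpha> i * f j (x i))))"
      by (simp add: sum_distrib_left distrib_left sum.distrib mult_ac)
    finally have "\<alpha> b * g u + (\<Sum>i\<in>J. \<alpha> i * g (x i)) = 0"
      by (simp add: eq)
    then have b0: "\<alpha> b = 0" using u by (simp add: g0)
    then have "\<forall>i\<in>J. \<alpha> i = 0"
      using eq by (intro T) auto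
    then show ?thesis using b0 by simp
  qed
  ultimately show ?case by blast
qed

lemma dual_system_mem: "dual_system J f U x N \<Longrightarrow> i \<in> J \<Longrightarrow> x i \<in> U"
  by (simp add: dual_system_def)

lemma dual_system_dual:
  "dual_system J f U x N \<Longrightarrow> j \<in> J \<Longrightarrow> j' \<in> J \<Longrightarrow> (\<Sum>i\<in>J. N j i * f j' (x i)) = of_bool (j = j')"
  by (simp add: dual_system_def)

lemma dual_system_eq_zero:
  assumes "dual_system J f U x N" "\<And>j. j \<in> J \<Longrightarrow> (\<Sum>i\<in>J. \<alpha> i * f j (x i)) = 0" "i \<in> J"
  shows "\<alpha> i = 0"
  using assms by (simp add: dual_system_def)

lemma sum_mult_of_bool:
  fixes g :: "'i \<Rightarrow> real"
  assumes "finite J" "j \<in> J" "\<And>i. i \<in> J \<Longrightarrow> h i = of_bool (j = i)"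
  shows "(\<Sum>i\<in>J. g i * h i) = g j"
  using assms by simp

lemma dual_system_combination:
  assumes "finite J" "dual_system J f U x N" "j \<in> J"
  shows "(\<Sum>i\<in>J. N j i * (\<Sum>l\<in>J. \<alpha> l * f l (x i))) = \<alpha> j"
proof -
  have "(\<Sum>i\<in>J. N j i * (\<Sum>l\<in>J. \<alpha> l * f l (x i))) = (\<Sum>l\<in>J. \<alpha> l * (\<Sum>i\<in>J. N j i * f l (x i)))"
    unfolding sum_distrib_left by (subst sum.swap) (simp only: mult_ac)
  also have "\<dots> = \<alpha> j"
    using assms by (intro sum_mult_of_bool dual_system_dual[OF assms(2)])
  finally show ?thesis .
qed

section \<open>Bounds for the matrix rank\<close>

text \<open>A trivial kernel makes the square sample matrix invertible, hence of full rank
  \<open>r\<close>. Points are numbered from 1 and matrix entries from 0, whence the shifts by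
  one.\<close>

lemma le_if_rank_at_most:
  assumes rank: "rank_at_most U V \<psi> m"
    and xy: "\<And>i. i \<in> {1..r} \<Longrightarrow> x i \<in> U" "\<And>i. i \<in> {1..r} \<Longrightarrow> y i \<in> V"
    and inj: "\<And>\<beta> j. (\<And>i. i \<in> {1..r} \<Longrightarrow> (\<Sum>j=1..r. \<psi> (x i) (y j) * \<beta> j) = 0) \<Longrightarrow> j \<in> {1..r} \<Longrightarrow> \<beta> j = 0"
  shows "r \<le> m"
proof -
  define A where "A = mat r r (\<lambda>(i, j). \<psi> (x (Suc i)) (y (Suc j)))"
  have A: "A \<in> carrier_mat r r" by (simp add: A_def)
  have "Determinant.det A \<noteq> 0"
  proof
    assume "Determinant.det A = 0"
    then obtain v where v: "v \<in> carrier_vec r" "v \<noteq> 0\<^sub>v r" "A *\<^sub>v v = 0\<^sub>v r"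
      using det_0_iff_vec_prod_zero_field[OF A] by blast
    have "vec_index v (j - 1) = 0" if j: "j \<in> {1..r}" for j
    proof (rule inj[of "\<lambda>j. vec_index v (j - 1)", OF _ j])
      fix i assume i: "i \<in> {1..r}"
      have "vec_index (A *\<^sub>v v) (i - 1) = 0"
        using v i by auto
      moreover have "vec_index (A *\<^sub>v v) (i - 1) = (\<Sum>j<r. \<psi> (x i) (y (Suc j)) * vec_index v j)"
        using i v(1) by (auto simp: A_def scalar_prod_def atLeast0LessThan)
      ultimately show "(\<Sum>j=1..r. \<psi> (x i) (y j) * vec_index v (j - 1)) = 0"
        by (simp add: sum.atLeast1_atMost_eq)
    qed
    then have "vec_index v j = 0" if "j < r" for j
      using that by (metis Suc_leI atLeastAtMost_iff diff_Suc_1 le_add1 plus_1_eq_Suc)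
    then have "v = 0\<^sub>v r" using v by auto
    then show False using v by simp
  qed
  then have "vec_space.rank r A = r"
    using vec_space.det_rank_iff[OF A] by blast
  moreover have "vec_space.rank r A \<le> m"
    using rank[unfolded rank_at_most_def, rule_format, of r "\<lambda>i. x (Suc i)" "\<lambda>i. y (Suc i)"] xy
    by (auto simp: A_def)
  ultimately show ?thesis by simp
qed

lemma rank_at_most_sum:
  assumes "\<And>x y. x \<in> U \<Longrightarrow> y \<in> V \<Longrightarrow> \<psi> x y = (\<Sum>j=1..k. \<phi> j x * \<xi> j y)"
  shows "rank_at_most U V \<psi> k"
  unfolding rank_at_most_def
proof (intro allI impI)
  fix m :: nat and x y assume xy: "\<forall>i<m. x i \<in> U \<and> y i \<in> V"
  have "vec_space.rank m (mat m m (\<lambda>(i, j). \<Sum>l=1..k. \<phi> l (x i) * \<xi> l (y j))) \<le> k"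
  proof (induction k)
    case 0
    have "mat m m (\<lambda>(i, j). \<Sum>l=1..0. \<phi> l (x i) * \<xi> l (y j)) = 0\<^sub>m m m"
      by (intro eq_matI) auto
    then show ?case
      using vec_space.rank_0I[of m m, where ?'a = real] by (simp only: le_refl)
  next
    case (Suc k)
    define A where "A = mat m m (\<lambda>(i, j). \<Sum>l=1..k. \<phi> l (x i) * \<xi> l (y j))"
    define B where "B = mat m m (\<lambda>(i, j). \<phi> (Suc k) (x i) * \<xi> (Suc k) (y j))"
    have "mat m m (\<lambda>(i, j). \<Sum>l=1..Suc k. \<phi> l (x i) * \<xi> l (y j)) = A + B"
      by (intro eq_matI) (auto simp: A_def B_def)
    moreover have "vec_space.rank m (A + B) \<le> vec_space.rank m A + vec_space.rank m B"
      by (intro vec_space.rank_subadditive[where nc = m]) (auto simp: A_def B_def)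
    moreover have "vec_space.rank m B \<le> 1"
      by (intro vec_space.rank_le_1_product_entries[where nc = m and f = "\<lambda>i. \<phi> (Suc k) (x i)"
            and g = "\<lambda>j. \<xi> (Suc k) (y j)"]) (auto simp: B_def)
    moreover have "vec_space.rank m A \<le> k"
      unfolding A_def by (rule Suc.IH)
    ultimately show ?case by (metis add_mono order_trans Suc_eq_plus1)
  qed
  moreover have "mat m m (\<lambda>(i, j). \<psi> (x i) (y j)) = mat m m (\<lambda>(i, j). \<Sum>l=1..k. \<phi> l (x i) * \<xi> l (y j))"
    using xy by (intro eq_matI) (auto simp: assms)
  ultimately show "vec_space.rank m (mat m m (\<lambda>(i, j). \<psi> (x i) (y j))) \<le> k"
    by simp
qed

section \<open>Separable representations and Taylor functions\<close>

lemma coeff_eq_zero_on: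
  fixes a :: "('n::finite \<Rightarrow> nat) \<Rightarrow> real"
  assumes "open V" "p \<in> V" and sums: "\<And>y. y \<in> V \<Longrightarrow> (\<lambda>l. homogeneous_part a l (y - p)) sums 0"
  shows "a s = 0"
proof -
  obtain r where r: "0 < r" "ball p r \<subseteq> V"
    using assms(1,2) open_contains_ball by blast
  show ?thesis
  proof (rule coeff_eq_zero[OF r(1)])
    fix z :: "real^'n" assume "norm z < r"
    then have "p + z \<in> V" using r(2) by (intro subsetD[OF r(2)]) (simp add: dist_norm)
    from sums[OF this] show "(\<lambda>l. homogeneous_part a l z) sums 0" by simp
  qed
qed

lemma zero_if_AE_zero:
  fixes g :: "'a::euclidean_space \<Rightarrow> real"
  assumes "open V" "continuous_on V g" "AE y\<in>V in lebesgue. g y = 0" "y \<in> V"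
  shows "g y = 0"
proof -
  have "open (V \<inter> g -` (- {0}))"
    using assms(2,1) by (rule continuous_open_preimage) (intro open_Compl closed_singleton)
  then have "closed (- (V \<inter> g -` (- {0})))" by blast
  moreover have "AE y in lebesgue. y \<in> - (V \<inter> g -` (- {0}))"
    using assms(3) by eventually_elim auto
  ultimately have "y \<in> - (V \<inter> g -` (- {0}))"
    by (rule mem_closed_if_AE_lebesgue)
  then show ?thesis using assms(4) by auto
qed

lemma C_infinity_combination:
  fixes U V :: "(real^'n) set"
  assumes "open V" "analytic_in_snd U V \<psi>" and x: "\<And>i. i \<in> I \<Longrightarrow> x i \<in> U"
  shows "C_infinity V (\<lambda>y. \<Sum>i\<in>I. N i * \<psi> (x i) y)"
  unfolding C_infinity_def
proof
  fix k
  have "locally_power_series V (\<lambda>y. \<Sum>i\<in>I. N i * \<psi> (x i) y)"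
    unfolding locally_power_series_def
  proof
    fix q assume "q \<in> V"
    then obtain c where c: "taylor_functions U V \<psi> q c"
      using assms(2) unfolding analytic_in_snd_def by blast
    obtain r where r: "0 < r" "ball q r \<subseteq> V"
      using \<open>open V\<close> \<open>q \<in> V\<close> open_contains_ball by blast
    show "\<exists>a r. 0 < r \<and> (\<forall>z. norm z < r \<longrightarrow> (\<lambda>l. homogeneous_part a l z) sums (\<Sum>i\<in>I. N i * \<psi> (x i) (q + z)))"
    proof (intro exI conjI allI impI)
      fix z :: "real^'n" assume "norm z < r"
      then have "q + z \<in> V" by (intro subsetD[OF r(2)]) (simp add: dist_norm)
      then have "(\<lambda>l. homogeneous_part (\<lambda>s. c s (x i)) l z) sums \<psi> (x i) (q + z)" if "i \<in> I" for i
        using c x[OF that] unfolding taylor_functions_def by force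
      then show "(\<lambda>l. homogeneous_part (\<lambda>s. \<Sum>i\<in>I. N i * c s (x i)) l z) sums (\<Sum>i\<in>I. N i * \<psi> (x i) (q + z))"
        by (rule sums_homogeneous_part_sum)
    qed (rule r(1))
  qed
  then show "C_k k V (\<lambda>y. \<Sum>i\<in>I. N i * \<psi> (x i) y)"
    by (rule locally_power_series_imp_C_k[OF \<open>open V\<close>])
qed

lemma C_infinity_imp_continuous_on: "C_infinity V f \<Longrightarrow> continuous_on V f"
  unfolding C_infinity_def using C_k.simps(1) by blast

text \<open>Two dual systems are used: points \<open>x i\<close> solve the representation for the
  \<open>\<xi> j\<close>, which yields their coefficients \<open>e j\<close>, and multi-indices
  \<open>s i\<close> solve the Taylor expansions for the \<open>\<phi> j\<close>. The functions
  \<open>c (s i)\<close> then form the basis.\<close>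

lemma basis_if_separable:
  fixes U V :: "(real^'n) set"
  assumes "open V" "p \<in> V" and c: "taylor_functions U V \<psi> p c" and "separable_with U V \<psi> k"
  shows "span_has_basis_of_size UNIV c U k"
proof -
  define I where "I = {1..k}"
  have fin: "finite I" and card: "card I = k" by (simp_all add: I_def)
  obtain \<phi> \<xi> where \<phi>: "lin_indep_ae I \<phi> U" and \<xi>: "lin_indep_ae I \<xi> V"
    and eq: "\<And>x y. x \<in> U \<Longrightarrow> y \<in> V \<Longrightarrow> \<psi> x y = (\<Sum>j\<in>I. \<phi> j x * \<xi> j y)"
    using assms(4) unfolding separable_with_def I_def by blast
  obtain x N where xN: "dual_system I \<phi> U x N"
    using dual_system_exists[OF fin lin_indep_ae_imp_lin_indep_on[OF \<phi> fin]] by blast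
  define e where "e = (\<lambda>j s. \<Sum>i\<in>I. N j i * c s (x i))"
  have e_sums: "(\<lambda>l. homogeneous_part (e j) l (y - p)) sums \<xi> j y" if "j \<in> I" "y \<in> V" for j y
  proof -
    have "(\<lambda>l. homogeneous_part (e j) l (y - p)) sums (\<Sum>i\<in>I. N j i * \<psi> (x i) y)"
      unfolding e_def using c dual_system_mem[OF xN] that
      by (intro sums_homogeneous_part_sum) (auto simp: taylor_functions_def)
    also have "(\<Sum>i\<in>I. N j i * \<psi> (x i) y) = (\<Sum>i\<in>I. N j i * (\<Sum>j'\<in>I. \<xi> j' y * \<phi> j' (x i)))"
      using dual_system_mem[OF xN] that by (simp add: eq mult.commute)
    also have "\<dots> = \<xi> j y" by (rule dual_system_combination[OF fin xN that(1)])
    finally show ?thesis .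
  qed
  have c_eq: "c s u = (\<Sum>j\<in>I. \<phi> j u * e j s)" if u: "u \<in> U" for s u
  proof -
    have "c s u - (\<Sum>j\<in>I. \<phi> j u * e j s) = 0"
    proof (rule coeff_eq_zero_on[OF assms(1,2), of "\<lambda>s. c s u - (\<Sum>j\<in>I. \<phi> j u * e j s)"])
      fix y assume y: "y \<in> V"
      have "(\<lambda>l. homogeneous_part (\<lambda>s. c s u) l (y - p)
              - homogeneous_part (\<lambda>s. \<Sum>j\<in>I. \<phi> j u * e j s) l (y - p))
          sums (\<psi> u y - (\<Sum>j\<in>I. \<phi> j u * \<xi> j y))"
        using c u y e_sums
        by (intro sums_diff sums_homogeneous_part_sum) (auto simp: taylor_functions_def)
      then show "(\<lambda>l. homogeneous_part (\<lambda>s. c s u - (\<Sum>j\<in>I. \<phi> j u * e j s)) l (y - p)) sums 0"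
        using u y by (simp add: homogeneous_part_diff eq)
    qed
    then show ?thesis by simp
  qed
  have "lin_indep_on I e UNIV"
    unfolding lin_indep_on_def
  proof (intro allI impI ballI)
    fix w j assume w: "\<forall>s\<in>UNIV. (\<Sum>j\<in>I. w j * e j s) = 0" and j: "j \<in> I"
    have "(\<Sum>j\<in>I. w j * \<xi> j y) = 0" if y: "y \<in> V" for y
    proof -
      have "(\<lambda>l. homogeneous_part (\<lambda>s. \<Sum>j\<in>I. w j * e j s) l (y - p)) sums (\<Sum>j\<in>I. w j * \<xi> j y)"
        using e_sums y by (intro sums_homogeneous_part_sum)
      moreover have "homogeneous_part (\<lambda>s. \<Sum>j\<in>I. w j * e j s) l (y - p) = 0" for l
        using w by (simp add: homogeneous_part_def)
      ultimately show ?thesis by (simp add: sums_iff)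
    qed
    then show "w j = 0"
      using lin_indep_aeD[OF \<xi> fin, of w j] j by simp
  qed
  then obtain s N' where sN': "dual_system I e UNIV s N'"
    using dual_system_exists[OF fin] by blast
  \<comment> \<open>Were two of the chosen multi-indices equal, the difference of the two
    evaluations would be a nontrivial relation. Injectivity gives the basis exactly \<open>k\<close>
    members.\<close>
  have inj: "inj_on s I"
  proof (rule inj_onI, rule ccontr)
    fix i i' assume *: "i \<in> I" "i' \<in> I" "s i = s i'" "i \<noteq> i'"
    have "of_bool (i = i) - of_bool (i = i') = (0::real)"
    proof (rule dual_system_eq_zero[OF sN', of "\<lambda>l. of_bool (l = i) - of_bool (l = i')", OF _ *(1)])
      fix j
      show "(\<Sum>l\<in>I. (of_bool (l = i) - of_bool (l = i')) * e j (s l)) = 0"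
        using * fin by (simp add: left_diff_distrib sum_subtractf)
    qed
    then show False using * by simp
  qed
  have "lin_indep_ae (s ` I) c U"
  proof (rule lin_indep_aeI)
    fix \<alpha> t assume ae: "AE u\<in>U in lebesgue. (\<Sum>t\<in>s ` I. \<alpha> t * c t u) = 0" and "t \<in> s ` I"
    then obtain i where i: "t = s i" "i \<in> I" by blast
    define \<beta> where "\<beta> = (\<lambda>j. \<Sum>i\<in>I. \<alpha> (s i) * e j (s i))"
    have sum_eq: "(\<Sum>t\<in>s ` I. \<alpha> t * c t u) = (\<Sum>j\<in>I. \<beta> j * \<phi> j u)" if "u \<in> U" for u
    proof -
      have "(\<Sum>t\<in>s ` I. \<alpha> t * c t u) = (\<Sum>i\<in>I. \<Sum>j\<in>I. \<alpha> (s i) * (\<phi> j u * e j (s i)))"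
        using that by (simp add: sum.reindex[OF inj] c_eq sum_distrib_left)
      also have "\<dots> = (\<Sum>j\<in>I. \<beta> j * \<phi> j u)"
        unfolding \<beta>_def sum_distrib_right by (subst sum.swap) (simp only: mult_ac)
      finally show ?thesis .
    qed
    have "AE u\<in>U in lebesgue. (\<Sum>j\<in>I. \<beta> j * \<phi> j u) = 0"
      using ae by eventually_elim (simp add: sum_eq)
    then have "\<beta> j = 0" if "j \<in> I" for j
      using lin_indep_aeD[OF \<phi> fin, of \<beta> j] that by simp
    then have "\<alpha> (s i) = 0"
      using i by (intro dual_system_eq_zero[OF sN', of "\<lambda>i. \<alpha> (s i)"]) (auto simp: \<beta>_def)
    then show "\<alpha> t = 0" using i by simp
  qed (simp add: fin)
  moreover have "\<exists>\<alpha>. \<forall>u\<in>U. c t u = (\<Sum>t'\<in>s ` I. \<alpha> t' * c t' u)" for t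
  proof -
    \<comment> \<open>Expand \<open>c t\<close> in the \<open>\<phi> j\<close>, then each
      \<open>\<phi> j\<close> in the \<open>c (s i)\<close>.\<close>
    define \<beta> where "\<beta> = (\<lambda>i. \<Sum>j\<in>I. e j t * N' j i)"
    have "c t u = (\<Sum>t'\<in>s ` I. \<beta> (the_inv_into I s t') * c t' u)" if u: "u \<in> U" for u
    proof -
      have \<phi>_eq: "\<phi> j u = (\<Sum>i\<in>I. N' j i * c (s i) u)" if j: "j \<in> I" for j
        unfolding c_eq[OF u] by (rule dual_system_combination[OF fin sN' j, symmetric])
      have "c t u = (\<Sum>j\<in>I. \<phi> j u * e j t)"
        by (rule c_eq[OF u])
      also have "\<dots> = (\<Sum>j\<in>I. (\<Sum>i\<in>I. N' j i * c (s i) u) * e j t)"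
        by (rule sum.cong[OF refl]) (simp only: \<phi>_eq)
      also have "\<dots> = (\<Sum>i\<in>I. \<beta> i * c (s i) u)"
        unfolding \<beta>_def sum_distrib_right by (subst sum.swap) (simp only: mult_ac)
      also have "\<dots> = (\<Sum>t'\<in>s ` I. \<beta> (the_inv_into I s t') * c t' u)"
        by (simp add: sum.reindex[OF inj] the_inv_into_f_f[OF inj])
      finally show ?thesis .
    qed
    then show ?thesis by (intro exI[of _ "\<lambda>t'. \<beta> (the_inv_into I s t')"] ballI)
  qed
  moreover have "card (s ` I) = k" using card_image[OF inj] card by simp
  ultimately show ?thesis
    unfolding span_has_basis_of_size_def using fin by (intro exI[of _ "s ` I"]) simp
qed

text \<open>\<open>separable_with\<close> fixes the index set \<open>{1..k}\<close>, whereas a basis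
  is indexed by multi-indices; a bijection carries the factors over.\<close>

lemma separable_withI:
  fixes \<phi> \<xi> :: "'i \<Rightarrow> real^'n \<Rightarrow> real"
  assumes "finite B" "card B = k"
    and \<phi>: "lin_indep_ae B \<phi> U" and \<xi>: "lin_indep_ae B \<xi> V"
    and smooth: "\<And>t. t \<in> B \<Longrightarrow> C_infinity V (\<xi> t)"
    and eq: "\<And>u y. u \<in> U \<Longrightarrow> y \<in> V \<Longrightarrow> \<psi> u y = (\<Sum>t\<in>B. \<phi> t u * \<xi> t y)"
  shows "separable_with U V \<psi> k"
proof -
  obtain h where h: "bij_betw h {1..k} B"
    using ex_bij_betw_nat_finite_1[OF assms(1)] assms(2) by blast
  define I where "I = {1..k}"
  have fin: "finite I" by (simp add: I_def)
  have bij: "bij_betw h I B" using h by (simp add: I_def)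
  have reindex: "(\<Sum>j\<in>I. g (h j)) = (\<Sum>t\<in>B. g t)" for g :: "_ \<Rightarrow> real"
    by (rule sum.reindex_bij_betw[OF bij])
  have hB: "h j \<in> B" if "j \<in> I" for j
    using bij that by (auto simp: bij_betw_def)
  have transfer: "lin_indep_ae I (\<lambda>j. f (h j)) S" if f: "lin_indep_ae B f S"
    for f :: "'i \<Rightarrow> real^'n \<Rightarrow> real" and S
  proof (rule lin_indep_aeI[OF fin])
    fix w j assume ae: "AE y\<in>S in lebesgue. (\<Sum>j\<in>I. w j * f (h j) y) = 0" and j: "j \<in> I"
    define w' where "w' = (\<lambda>t. w (the_inv_into I h t))"
    have inv: "w' (h j) = w j" if "j \<in> I" for j
      using bij that by (simp add: w'_def bij_betw_def the_inv_into_f_f)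
    have "(\<Sum>j\<in>I. w j * f (h j) y) = (\<Sum>t\<in>B. w' t * f t y)" for y
      unfolding reindex[of "\<lambda>t. w' t * f t y", symmetric]
      by (rule sum.cong[OF refl]) (simp only: inv)
    then have "w' (h j) = 0"
      using ae lin_indep_aeD[OF f assms(1), of w' "h j"] hB[OF j] by simp
    then show "w j = 0" using inv[OF j] by simp
  qed
  show ?thesis
    unfolding separable_with_def I_def[symmetric]
  proof (intro exI conjI ballI)
    show "lin_indep_ae I (\<lambda>j. \<phi> (h j)) U" by (rule transfer[OF \<phi>])
    show "lin_indep_ae I (\<lambda>j. \<xi> (h j)) V" by (rule transfer[OF \<xi>])
    show "C_infinity V (\<xi> (h j))" if "j \<in> I" for j
      by (rule smooth[OF hB[OF that]])
    show "\<psi> u y = (\<Sum>j\<in>I. \<phi> (h j) u * \<xi> (h j) y)" if "u \<in> U" "y \<in> V" for u y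
      unfolding reindex[of "\<lambda>t. \<phi> t u * \<xi> t y"] by (rule eq[OF that])
  qed
qed

text \<open>The basis functions \<open>c t\<close> are the first factors. The second factors are
  combinations of sections of \<psi>, and their power series coefficients are the coordinates of the
  \<open>c s\<close> in the basis.\<close>

lemma separable_if_basis:
  fixes U V :: "(real^'n) set"
  assumes "open V" "p \<in> V" "analytic_in_snd U V \<psi>" and c: "taylor_functions U V \<psi> p c"
    and "span_has_basis_of_size UNIV c U k"
  shows "separable_with U V \<psi> k"
proof -
  obtain B where B: "finite B" "card B = k" and indep: "lin_indep_ae B c U"
    and ex: "\<forall>s. \<exists>\<alpha>. \<forall>x\<in>U. c s x = (\<Sum>t\<in>B. \<alpha> t * c t x)"
    using assms(5) unfolding span_has_basis_of_size_def by auto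
  from choice[OF ex] obtain \<alpha> where "\<forall>s. \<forall>x\<in>U. c s x = (\<Sum>t\<in>B. \<alpha> s t * c t x)" ..
  then have \<alpha>: "c s x = (\<Sum>t\<in>B. \<alpha> s t * c t x)" if "x \<in> U" for s x
    using that by blast
  obtain x N where xN: "dual_system B c U x N"
    using dual_system_exists[OF B(1) lin_indep_ae_imp_lin_indep_on[OF indep B(1)]] by blast
  define \<xi> where "\<xi> = (\<lambda>t y. \<Sum>i\<in>B. N t i * \<psi> (x i) y)"
  have smooth: "C_infinity V (\<xi> t)" for t
    unfolding \<xi>_def by (rule C_infinity_combination[OF assms(1,3) dual_system_mem[OF xN]])
  have N\<alpha>: "(\<Sum>i\<in>B. N t i * c s (x i)) = \<alpha> s t" if "t \<in> B" for s t
  proof -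
    have "(\<Sum>i\<in>B. N t i * c s (x i)) = (\<Sum>i\<in>B. N t i * (\<Sum>t'\<in>B. \<alpha> s t' * c t' (x i)))"
      by (rule sum.cong[OF refl]) (simp only: \<alpha>[OF dual_system_mem[OF xN], of _ s])
    also have "\<dots> = \<alpha> s t" by (rule dual_system_combination[OF B(1) xN that])
    finally show ?thesis .
  qed
  have \<xi>_sums: "(\<lambda>l. homogeneous_part (\<lambda>s. \<alpha> s t) l (y - p)) sums \<xi> t y" if "t \<in> B" "y \<in> V" for t y
  proof -
    have "(\<lambda>l. homogeneous_part (\<lambda>s. \<Sum>i\<in>B. N t i * c s (x i)) l (y - p)) sums \<xi> t y"
      unfolding \<xi>_def using c dual_system_mem[OF xN] that
      by (intro sums_homogeneous_part_sum) (auto simp: taylor_functions_def)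
    then show ?thesis using that by (simp only: N\<alpha>)
  qed
  have \<psi>_eq: "\<psi> u y = (\<Sum>t\<in>B. c t u * \<xi> t y)" if u: "u \<in> U" and y: "y \<in> V" for u y
  proof -
    have "(\<lambda>l. homogeneous_part (\<lambda>s. \<Sum>t\<in>B. c t u * \<alpha> s t) l (y - p)) sums (\<Sum>t\<in>B. c t u * \<xi> t y)"
      by (rule sums_homogeneous_part_sum) (rule \<xi>_sums[OF _ y])
    moreover have "(\<lambda>s. \<Sum>t\<in>B. c t u * \<alpha> s t) = (\<lambda>s. c s u)"
    proof
      show "(\<Sum>t\<in>B. c t u * \<alpha> s t) = c s u" for s
        unfolding \<alpha>[OF u, of s] by (simp only: mult.commute)
    qed
    moreover have "(\<lambda>l. homogeneous_part (\<lambda>s. c s u) l (y - p)) sums \<psi> u y"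
      using c u y by (simp add: taylor_functions_def)
    ultimately show ?thesis by (simp only: sums_iff)
  qed
  have "lin_indep_ae B \<xi> V"
  proof (rule lin_indep_aeI[OF B(1)])
    fix w t assume ae: "AE y\<in>V in lebesgue. (\<Sum>t\<in>B. w t * \<xi> t y) = 0" and t: "t \<in> B"
    have cont: "continuous_on V (\<lambda>y. \<Sum>t\<in>B. w t * \<xi> t y)"
      by (intro continuous_on_sum continuous_on_mult continuous_on_const C_infinity_imp_continuous_on smooth)
    \<comment> \<open>The coordinates of a basis member are Kronecker deltas, so the coefficient at
      the multi-index \<open>t\<close> is \<open>w t\<close>; uniqueness of coefficients makes it
      zero.\<close>
    have "(\<Sum>t'\<in>B. w t' * \<alpha> t t') = 0"
    proof (rule coeff_eq_zero_on[OF assms(1,2), of "\<lambda>s. \<Sum>t'\<in>B. w t' * \<alpha> s t'"])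
      fix y assume y: "y \<in> V"
      have "(\<lambda>l. homogeneous_part (\<lambda>s. \<Sum>t'\<in>B. w t' * \<alpha> s t') l (y - p)) sums (\<Sum>t\<in>B. w t * \<xi> t y)"
        by (rule sums_homogeneous_part_sum) (rule \<xi>_sums[OF _ y])
      then show "(\<lambda>l. homogeneous_part (\<lambda>s. \<Sum>t'\<in>B. w t' * \<alpha> s t') l (y - p)) sums 0"
        using zero_if_AE_zero[OF assms(1) cont ae y] by simp
    qed
    moreover have "(\<Sum>t'\<in>B. w t' * \<alpha> t t') = w t"
    proof (rule sum_mult_of_bool[OF B(1) t])
      show "\<alpha> t t' = of_bool (t = t')" if "t' \<in> B" for t'
        using N\<alpha>[OF that, of t] dual_system_dual[OF xN that t] by auto
    qed
    ultimately show "w t = 0" by simp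
  qed
  then show ?thesis
    by (rule separable_withI[OF B indep _ smooth \<psi>_eq])
qed

section \<open>Rank and separable representations\<close>

text \<open>For the lower bound, at dual points of both families the sample matrix is a product of
  two invertible matrices, so its kernel is trivial.\<close>

lemma has_rank_if_separable:
  fixes U V :: "(real^'n) set"
  assumes "separable_with U V \<psi> k"
  shows "has_rank U V \<psi> k"
  unfolding has_rank_def
proof (intro conjI allI impI)
  define I where "I = {1..k}"
  have fin: "finite I" by (simp add: I_def)
  obtain \<phi> \<xi> where \<phi>: "lin_indep_ae I \<phi> U" and \<xi>: "lin_indep_ae I \<xi> V"
    and eq: "\<And>x y. x \<in> U \<Longrightarrow> y \<in> V \<Longrightarrow> \<psi> x y = (\<Sum>j\<in>I. \<phi> j x * \<xi> j y)"
    using assms unfolding separable_with_def I_def by blast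
  show "rank_at_most U V \<psi> k" by (rule rank_at_most_sum[OF eq[unfolded I_def]])
  fix k' assume rank: "rank_at_most U V \<psi> k'"
  obtain x N where xN: "dual_system I \<phi> U x N"
    using dual_system_exists[OF fin lin_indep_ae_imp_lin_indep_on[OF \<phi> fin]] by blast
  obtain y N' where yN': "dual_system I \<xi> V y N'"
    using dual_system_exists[OF fin lin_indep_ae_imp_lin_indep_on[OF \<xi> fin]] by blast
  note x = dual_system_mem[OF xN] and y = dual_system_mem[OF yN']
  show "k \<le> k'"
  proof (rule le_if_rank_at_most[OF rank, of k x y, folded I_def])
    fix \<beta> j
    assume *: "\<And>i. i \<in> I \<Longrightarrow> (\<Sum>j\<in>I. \<psi> (x i) (y j) * \<beta> j) = 0" and j: "j \<in> I"
    define S where "S = (\<lambda>l. \<Sum>j\<in>I. \<beta> j * \<xi> l (y j))"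
    have S: "(\<Sum>j\<in>I. \<psi> (x i) (y j) * \<beta> j) = (\<Sum>l\<in>I. S l * \<phi> l (x i))" if "i \<in> I" for i
    proof -
      have "(\<Sum>j\<in>I. \<psi> (x i) (y j) * \<beta> j) = (\<Sum>j\<in>I. \<Sum>l\<in>I. \<phi> l (x i) * \<xi> l (y j) * \<beta> j)"
        using x[OF that] y by (intro sum.cong) (auto simp: eq sum_distrib_right)
      also have "\<dots> = (\<Sum>l\<in>I. S l * \<phi> l (x i))"
        unfolding S_def sum_distrib_right by (subst sum.swap) (simp only: mult_ac)
      finally show ?thesis .
    qed
    have "S l = 0" if "l \<in> I" for l
    proof -
      have "(\<Sum>i\<in>I. N l i * (\<Sum>l'\<in>I. S l' * \<phi> l' (x i))) = 0"
        using * by (intro sum.neutral) (auto simp: S)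
      then show ?thesis unfolding dual_system_combination[OF fin xN that] .
    qed
    then show "\<beta> j = 0"
      using j by (intro dual_system_eq_zero[OF yN', of \<beta>]) (auto simp: S_def)
  qed (fact x y)+
qed

text \<open>The sections in a maximal family are at first independent only pointwise;
  \<open>null_combinations_vanish\<close> raises this to independence up to null sets.\<close>

lemma separable_if_has_rank:
  fixes U V :: "(real^'n) set"
  assumes "open V" "analytic_in_snd U V \<psi>" "null_combinations_vanish U V \<psi>" "has_rank U V \<psi> k"
  shows "separable_with U V \<psi> k"
proof -
  have rank: "rank_at_most U V \<psi> k" and least: "\<And>k'. rank_at_most U V \<psi> k' \<Longrightarrow> k \<le> k'"
    using assms(4) unfolding has_rank_def by auto
  \<comment> \<open>A maximal linearly independent family of sections \<open>\<lambda>x. \<psi> x (y j)\<close> provides the \<open>\<phi>\<^sub>j\<close>.\<close>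
  define P where "P = (\<lambda>r::nat. \<exists>y. (\<forall>j\<in>{1..r}. y j \<in> V) \<and> lin_indep_on {1..r} (\<lambda>j x. \<psi> x (y j)) U)"
  \<comment> \<open>Independent sections yield an invertible sample matrix of size \<open>r\<close>,
    so the rank bounds \<open>r\<close> and a greatest such \<open>r\<close> exists.\<close>
  have le: "r \<le> k" if "P r" for r
  proof -
    obtain y where y: "\<And>j. j \<in> {1..r} \<Longrightarrow> y j \<in> V"
      and indep: "lin_indep_on {1..r} (\<lambda>j x. \<psi> x (y j)) U"
      using \<open>P r\<close> unfolding P_def by blast
    obtain x N where xN: "dual_system {1..r} (\<lambda>j x. \<psi> x (y j)) U x N"
      using dual_system_exists[OF finite_atLeastAtMost indep] by blast
    show ?thesis
    proof (rule le_if_rank_at_most[OF rank dual_system_mem[OF xN] y])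
      fix \<beta> j
      assume *: "\<And>i. i \<in> {1..r} \<Longrightarrow> (\<Sum>j=1..r. \<psi> (x i) (y j) * \<beta> j) = 0" and j: "j \<in> {1..r}"
      have "(\<Sum>i=1..r. N j i * (\<Sum>j=1..r. \<beta> j * \<psi> (x i) (y j))) = 0"
        by (intro sum.neutral ballI) (simp only: * mult.commute[of "\<beta> _"] mult_zero_right)
      then show "\<beta> j = 0"
        unfolding dual_system_combination[OF finite_atLeastAtMost xN j] .
    qed
  qed
  have "P 0" by (simp add: P_def lin_indep_on_def)
  define r where "r = (GREATEST r. P r)"
  have "P r" unfolding r_def using \<open>P 0\<close> le by (rule GreatestI_nat)
  have max: "\<not> P (Suc r)"
  proof
    assume "P (Suc r)"
    then have "Suc r \<le> r" unfolding r_def using le by (rule Greatest_le_nat)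
    then show False by simp
  qed
  define I where "I = {1..r}"
  have fin: "finite I" and card: "card I = r" by (simp_all add: I_def)
  have I_Suc: "{1..Suc r} = insert (Suc r) I" "Suc r \<notin> I" by (auto simp: I_def)
  obtain y where y: "\<And>j. j \<in> I \<Longrightarrow> y j \<in> V"
    and indep: "lin_indep_on I (\<lambda>j x. \<psi> x (y j)) U"
    using \<open>P r\<close> unfolding P_def I_def by blast
  obtain x N where xN: "dual_system I (\<lambda>j x. \<psi> x (y j)) U x N"
    using dual_system_exists[OF fin indep] by blast
  note x = dual_system_mem[OF xN]
  define \<xi> where "\<xi> = (\<lambda>j v. \<Sum>i\<in>I. N j i * \<psi> (x i) v)"
  have dual: "\<xi> j (y j') = of_bool (j = j')" if "j \<in> I" "j' \<in> I" for j j'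
    unfolding \<xi>_def by (rule dual_system_dual[OF xN that])
  have smooth: "C_infinity V (\<xi> j)" for j
    unfolding \<xi>_def by (rule C_infinity_combination[OF assms(1,2) x])
  \<comment> \<open>If the formula failed at some \<open>u\<close> and \<open>v\<close>, adjoining
    \<open>v\<close> would give a larger independent family: the dual functionals express all
    coefficients of a relation through the last one, and the failure forces that one to
    vanish.\<close>
  have \<psi>_eq: "\<psi> u v = (\<Sum>j\<in>I. \<psi> u (y j) * \<xi> j v)" if u: "u \<in> U" and v: "v \<in> V" for u v
  proof (rule ccontr)
    assume neq: "\<psi> u v \<noteq> (\<Sum>j\<in>I. \<psi> u (y j) * \<xi> j v)"
    define y' where "y' = y(Suc r := v)"
    have y'_I: "y' j = y j" if "j \<in> I" for j
      using that I_Suc by (auto simp: y'_def)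
    have "lin_indep_on {1..Suc r} (\<lambda>j x. \<psi> x (y' j)) U"
      unfolding lin_indep_on_def I_Suc(1)
    proof (intro allI impI)
      fix \<alpha> assume 0: "\<forall>x\<in>U. (\<Sum>j\<in>insert (Suc r) I. \<alpha> j * \<psi> x (y' j)) = 0"
      have *: "(\<Sum>j\<in>I. \<alpha> j * \<psi> x (y j)) + \<alpha> (Suc r) * \<psi> x v = 0" if "x \<in> U" for x
      proof -
        have "(\<Sum>j\<in>I. \<alpha> j * \<psi> x (y' j)) = (\<Sum>j\<in>I. \<alpha> j * \<psi> x (y j))"
          by (rule sum.cong[OF refl]) (simp only: y'_I)
        then show ?thesis
          using 0[rule_format, OF that] fin I_Suc(2) by (simp add: y'_def)
      qed
      have \<alpha>: "\<alpha> j = - \<alpha> (Suc r) * \<xi> j v" if j: "j \<in> I" for j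
      proof -
        have "\<alpha> j = (\<Sum>i\<in>I. N j i * (\<Sum>l\<in>I. \<alpha> l * \<psi> (x i) (y l)))"
          by (rule dual_system_combination[OF fin xN j, symmetric])
        also have "\<dots> = (\<Sum>i\<in>I. - \<alpha> (Suc r) * (N j i * \<psi> (x i) v))"
        proof (rule sum.cong[OF refl])
          fix i assume "i \<in> I"
          then have "(\<Sum>l\<in>I. \<alpha> l * \<psi> (x i) (y l)) = - \<alpha> (Suc r) * \<psi> (x i) v"
            using *[OF x] by (simp add: eq_neg_iff_add_eq_0)
          then show "N j i * (\<Sum>l\<in>I. \<alpha> l * \<psi> (x i) (y l)) = - \<alpha> (Suc r) * (N j i * \<psi> (x i) v)"
            by simp
        qed
        also have "\<dots> = - \<alpha> (Suc r) * \<xi> j v"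
          unfolding \<xi>_def by (rule sum_distrib_left[symmetric])
        finally show ?thesis .
      qed
      have "(\<Sum>j\<in>I. \<alpha> j * \<psi> u (y j)) = (\<Sum>j\<in>I. - \<alpha> (Suc r) * (\<psi> u (y j) * \<xi> j v))"
        by (rule sum.cong[OF refl]) (simp add: \<alpha>)
      also have "\<dots> = - \<alpha> (Suc r) * (\<Sum>j\<in>I. \<psi> u (y j) * \<xi> j v)"
        by (rule sum_distrib_left[symmetric])
      finally have "\<alpha> (Suc r) * (\<psi> u v - (\<Sum>j\<in>I. \<psi> u (y j) * \<xi> j v)) = 0"
        using *[OF u] by (simp add: right_diff_distrib)
      then have "\<alpha> (Suc r) = 0" using neq by simp
      then show "\<forall>j\<in>insert (Suc r) I. \<alpha> j = 0"
        using \<alpha> by auto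
    qed
    moreover have "\<forall>j\<in>{1..Suc r}. y' j \<in> V"
      unfolding I_Suc(1) using y v y'_I by (auto simp: y'_def)
    ultimately have "P (Suc r)" unfolding P_def by blast
    then show False using max by simp
  qed
  have "rank_at_most U V \<psi> r"
    by (rule rank_at_most_sum[OF \<psi>_eq[unfolded I_def]])
  then have "r = k" using least le[OF \<open>P r\<close>] by force
  have inj: "inj_on y I"
  proof (rule inj_onI, rule ccontr)
    fix i j assume ij: "i \<in> I" "j \<in> I" "y i = y j" "i \<noteq> j"
    then show False using dual[of i i] dual[of i j] by simp
  qed
  have indep_\<phi>: "lin_indep_ae I (\<lambda>j x. \<psi> x (y j)) U"
  proof (rule lin_indep_aeI[OF fin])
    fix \<alpha> j assume ae: "AE x\<in>U in lebesgue. (\<Sum>j\<in>I. \<alpha> j * \<psi> x (y j)) = 0" and j: "j \<in> I"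
    \<comment> \<open>\<open>null_combinations_vanish\<close> takes coefficients indexed by points
      of \<open>V\<close>, so they are relabelled along the injective \<open>y\<close>.\<close>
    define \<alpha>' where "\<alpha>' = (\<lambda>v. \<alpha> (the_inv_into I y v))"
    have sum_eq: "(\<Sum>v\<in>y ` I. \<alpha>' v * \<psi> x v) = (\<Sum>j\<in>I. \<alpha> j * \<psi> x (y j))" for x
      by (simp add: sum.reindex[OF inj] \<alpha>'_def the_inv_into_f_f[OF inj])
    have "finite (y ` I) \<and> y ` I \<subseteq> V \<and> (AE x\<in>U in lebesgue. (\<Sum>v\<in>y ` I. \<alpha>' v * \<psi> x v) = 0)"
      unfolding sum_eq using ae y fin by auto
    then have "(\<Sum>v\<in>y ` I. \<alpha>' v * \<psi> x v) = 0" if "x \<in> U" for x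
      using assms(3) that unfolding null_combinations_vanish_def by blast
    then show "\<alpha> j = 0"
      unfolding sum_eq by (rule lin_indep_onD[OF indep _ j])
  qed
  have indep_\<xi>: "lin_indep_ae I \<xi> V"
  proof (rule lin_indep_aeI[OF fin])
    fix \<alpha> j assume ae: "AE v\<in>V in lebesgue. (\<Sum>j\<in>I. \<alpha> j * \<xi> j v) = 0" and j: "j \<in> I"
    have cont: "continuous_on V (\<lambda>v. \<Sum>j\<in>I. \<alpha> j * \<xi> j v)"
      by (intro continuous_on_sum continuous_on_mult continuous_on_const C_infinity_imp_continuous_on smooth)
    have "(\<Sum>i\<in>I. \<alpha> i * \<xi> i (y j)) = 0"
      by (rule zero_if_AE_zero[OF assms(1) cont ae y[OF j]])
    moreover have "(\<Sum>i\<in>I. \<alpha> i * \<xi> i (y j)) = \<alpha> j"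
      by (rule sum_mult_of_bool[OF fin j]) (use dual j in auto)
    ultimately show "\<alpha> j = 0" by simp
  qed
  show ?thesis
    using separable_withI[OF fin card indep_\<phi> indep_\<xi> smooth \<psi>_eq] unfolding \<open>r = k\<close> .
qed

text \<open>The representation and the basis condition are equivalent outright and imply the rank
  condition. The way back from the rank assumes \<open>null_combinations_vanish\<close>, which every
  representation implies by \<open>null_combinations_vanish_if_separable\<close>.\<close>

theorem proposition1:
  fixes U V :: "(real^'n) set" and \<psi> :: "real^'n \<Rightarrow> real^'n \<Rightarrow> real" and k :: nat
  assumes "open U" and "connected U" and "open V" and "connected V" and "V \<noteq> {}"
    and "analytic_in_snd U V \<psi>"
  shows "(separable_with U V \<psi> k
            \<longleftrightarrow> (\<forall>p\<in>V. \<forall>c. taylor_functions U V \<psi> p c \<longrightarrow> span_has_basis_of_size UNIV c U k))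
       \<and> (separable_with U V \<psi> k \<longrightarrow> has_rank U V \<psi> k)
       \<and> (null_combinations_vanish U V \<psi> \<longrightarrow> has_rank U V \<psi> k \<longrightarrow> separable_with U V \<psi> k)"
proof (intro conjI iffI impI ballI allI)
  show "span_has_basis_of_size UNIV c U k"
    if "separable_with U V \<psi> k" "p \<in> V" "taylor_functions U V \<psi> p c" for p c
    using basis_if_separable[OF \<open>open V\<close> that(2,3,1)] .
  show "separable_with U V \<psi> k"
    if *: "\<forall>p\<in>V. \<forall>c. taylor_functions U V \<psi> p c \<longrightarrow> span_has_basis_of_size UNIV c U k"
  proof -
    \<comment> \<open>For empty \<open>V\<close> the assumption would be vacuous;
      \<open>V \<noteq> {}\<close> supplies the point whose Taylor functions are used.\<close>
    obtain p where "p \<in> V" using \<open>V \<noteq> {}\<close> by blast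
    moreover obtain c where "taylor_functions U V \<psi> p c"
      using assms(6) \<open>p \<in> V\<close> unfolding analytic_in_snd_def by blast
    ultimately show ?thesis
      using * by (intro separable_if_basis[OF \<open>open V\<close> _ assms(6)]) auto
  qed
  show "has_rank U V \<psi> k" if "separable_with U V \<psi> k"
    using that by (rule has_rank_if_separable)
  show "separable_with U V \<psi> k" if "null_combinations_vanish U V \<psi>" "has_rank U V \<psi> k"
    using separable_if_has_rank[OF \<open>open V\<close> assms(6) that] .
qed

end
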